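(* Let $n\ge2$ and $T=\langle a,b\mid a^{2n}=1,\ a^n=b^2,\ a^b=a^{-1}\rangle\cong Q_{4n}$. Let $\Gamma$ be a connected Cayley graph over $T$ and $G$ a group with $T\le G\le\mathrm{Aut}(\Gamma)$ (where $T$ is identified with its right regular action on $V(\Gamma)=T$) such that $\Gamma$ is $(G,2)$-distance-transitive. Suppose $\Gamma\not\cong{\rm K}_{m[f]}$ for all $m\ge3$, $f\ge2$. Let $N$ be a normal subgroup of $G$ maximal with respect to having at least $3$ orbits on $V(\Gamma)$. Then $\Gamma$ is a cover of the quotient graph $\Gamma_N$, $\Gamma_N$ is a $(G/N,s)$-distance-transitive Cayley graph over $T/N$ where $s=\min\{2,\mathrm{diam}(\Gamma_N)\}$, and $G/N$ acts faithfully on $V(\Gamma_N)$ and is either quasiprimitive or bi-quasiprimitive on $V(\Gamma_N)$. Moreover, $N=\langle a^i\rangle$ for some divisor $i$ of $2n$ with $i\neq1,2n$, and one of the following holds: (1) $T/N\cong\mathbb{Z}_2\times\mathbb{Z}_2$, $i=2$ and $n$ is even; (2) $T/N\cong\mathbb{Z}_4$, $i=2$ and $n$ is odd; (3) $T/N\cong Q_{2i}$ (the generalized quaternion group of order $2i$), where $i\ge3$ is even and $i$ does not divide $n$; (4) $T/N\cong D_{2i}$ (the dihedral group of order $2i$), where $i\ge3$ and $i$ divides $n$.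
   Context: Graphs are finite, simple, undirected. For $G\le\mathrm{Aut}(\Gamma)$ and $s\ge1$, $\Gamma$ is $(G,s)$-distance-transitive if $G$ is transitive on $V(\Gamma)$ and, for each $i\le s$, $G$ is transitive on the ordered pairs of vertices at distance $i$. The Cayley graph $\mathrm{Cay}(T,S)$ ($1\notin S=S^{-1}$) has vertex set $T$ and edges $\{g,sg\}$. ${\rm K}_{m[f]}$ is the complete multipartite graph with $m$ parts of size $f$. For a normal subgroup $N$ of $G$, the quotient graph $\Gamma_N$ has the $N$-orbits as vertices, two orbits adjacent iff some vertices of them are adjacent in $\Gamma$; $\Gamma$ is a cover of $\Gamma_N$ if for each edge $\{B,C\}$ of $\Gamma_N$ every vertex of $B$ has exactly one neighbour in $C$. A transitive permutation group is quasiprimitive if every nontrivial normal subgroup is transitive, and bi-quasiprimitive if every nontrivial normal subgroup has at most two orbits and some normal subgroup has exactly two orbits. The generalized quaternion group $Q_{4m}$ ($m\ge2$) is $\langle x,y\mid x^{2m}=1,y^2=x^m,y^{-1}xy=x^{-1}\rangle$.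
   Formalization: The claim i ≠ 2n is asserted only when N is nontrivial: for Γ = K_{4n} and G = Aut(Γ) one has N = 1 = ⟨a^{2n}⟩, so i = 2n is forced; all other conclusions are still asserted when N = 1. *)

theory Defs
  imports "HOL-Algebra.Group_Action" "HOL-Algebra.Elementary_Groups"
begin

section \<open>Groups given by generators and relations\<close>

datatype 'g letter = Pos 'g | Neg 'g

type_synonym 'g word = "'g letter list"

text \<open>A pair \<open>(l, r)\<close> in \<open>R\<close> stands for the relation \<open>l = r\<close>. Two words are related iff they
  represent the same element of the quotient of the free group by the normal closure of all
  \<open>l r\<close>\<open>\<^sup>-\<^sup>1\<close>.\<close>

inductive word_eq :: "('g word \<times> 'g word) set \<Rightarrow> 'g word \<Rightarrow> 'g word \<Rightarrow> bool" for R where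
  relation: "(l, r) \<in> R \<Longrightarrow> word_eq R (u @ l @ v) (u @ r @ v)"
| cancel_pos_neg: "word_eq R (u @ [Pos x, Neg x] @ v) (u @ v)"
| cancel_neg_pos: "word_eq R (u @ [Neg x, Pos x] @ v) (u @ v)"
| refl: "word_eq R u u"
| sym: "word_eq R u v \<Longrightarrow> word_eq R v u"
| trans: "word_eq R u v \<Longrightarrow> word_eq R v w \<Longrightarrow> word_eq R u w"

definition word_class :: "('g word \<times> 'g word) set \<Rightarrow> 'g word \<Rightarrow> 'g word set" where
  "word_class R u = {v. word_eq R u v}"

definition presented_group :: "('g word \<times> 'g word) set \<Rightarrow> 'g word set monoid" where
  "presented_group R =
    \<lparr>carrier = range (word_class R),
     mult = (\<lambda>A B. \<Union>u\<in>A. \<Union>v\<in>B. word_class R (u @ v)),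
     one = word_class R []\<rparr>"

datatype gen = GenX | GenY

definition quaternion_relations :: "nat \<Rightarrow> (gen word \<times> gen word) set" where
  "quaternion_relations m =
    {(replicate (2 * m) (Pos GenX), []),
     ([Pos GenY, Pos GenY], replicate m (Pos GenX)),
     ([Neg GenY, Pos GenX, Pos GenY], [Neg GenX])}"

definition dihedral_relations :: "nat \<Rightarrow> (gen word \<times> gen word) set" where
  "dihedral_relations m =
    {(replicate m (Pos GenX), []),
     ([Pos GenY, Pos GenY], []),
     ([Neg GenY, Pos GenX, Pos GenY], [Neg GenX])}"

text \<open>The parameter is such that the orders are \<open>4m\<close> and \<open>2m\<close>, respectively.\<close>

definition generalized_quaternion_group :: "nat \<Rightarrow> gen word set monoid" where
  "generalized_quaternion_group m = presented_group (quaternion_relations m)"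

definition dihedral_group :: "nat \<Rightarrow> gen word set monoid" where
  "dihedral_group m = presented_group (dihedral_relations m)"

text \<open>\<open>T = \<langle>a, b | R(a, b)\<rangle>\<close>, where \<open>GenX\<close> and \<open>GenY\<close> stand for \<open>a\<close> and \<open>b\<close>.\<close>

definition presented_by ::
  "('t, 'm) monoid_scheme \<Rightarrow> 't \<Rightarrow> 't \<Rightarrow> (gen word \<times> gen word) set \<Rightarrow> bool" where
  "presented_by T a b R \<longleftrightarrow>
    (\<exists>h \<in> iso (presented_group R) T.
       h (word_class R [Pos GenX]) = a \<and> h (word_class R [Pos GenY]) = b)"


section \<open>Graphs\<close>

record 'v graph =
  vertices :: "'v set"
  edges :: "'v set set"

definition finite_simple_graph :: "'v graph \<Rightarrow> bool" where
  "finite_simple_graph \<Gamma> \<longleftrightarrow>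
    finite (vertices \<Gamma>) \<and> (\<forall>e \<in> edges \<Gamma>. e \<subseteq> vertices \<Gamma> \<and> card e = 2)"

definition adj :: "'v graph \<Rightarrow> ('v \<times> 'v) set" where
  "adj \<Gamma> = {(u, v). {u, v} \<in> edges \<Gamma>}"

definition connected_graph :: "'v graph \<Rightarrow> bool" where
  "connected_graph \<Gamma> \<longleftrightarrow> (\<forall>u \<in> vertices \<Gamma>. \<forall>v \<in> vertices \<Gamma>. (u, v) \<in> (adj \<Gamma>)\<^sup>*)"

text \<open>\<open>(adj \<Gamma>) ^^ i\<close> relates the end vertices of walks of length \<open>i\<close>. Vertices in different
  components are at no distance from each other.\<close>

definition at_distance :: "'v graph \<Rightarrow> nat \<Rightarrow> 'v \<Rightarrow> 'v \<Rightarrow> bool" where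
  "at_distance \<Gamma> i u v \<longleftrightarrow>
    u \<in> vertices \<Gamma> \<and> v \<in> vertices \<Gamma> \<and>
    (u, v) \<in> (adj \<Gamma>) ^^ i \<and> (\<forall>j < i. (u, v) \<notin> (adj \<Gamma>) ^^ j)"

definition diam :: "'v graph \<Rightarrow> nat" where
  "diam \<Gamma> = Max {i. \<exists>u v. at_distance \<Gamma> i u v}"

definition graph_isomorphic :: "'v graph \<Rightarrow> 'w graph \<Rightarrow> bool" where
  "graph_isomorphic \<Gamma> \<Delta> \<longleftrightarrow>
    (\<exists>h. bij_betw h (vertices \<Gamma>) (vertices \<Delta>) \<and>
      (\<forall>u \<in> vertices \<Gamma>. \<forall>v \<in> vertices \<Gamma>. (u, v) \<in> adj \<Gamma> \<longleftrightarrow> (h u, h v) \<in> adj \<Delta>))"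

definition complete_multipartite :: "nat \<Rightarrow> nat \<Rightarrow> (nat \<times> nat) graph" where
  "complete_multipartite m f =
    \<lparr>vertices = {..<m} \<times> {..<f},
     edges = {{(i, j), (k, l)} | i j k l. i < m \<and> j < f \<and> k < m \<and> l < f \<and> i \<noteq> k}\<rparr>"

definition cayley_graph :: "('t, 'm) monoid_scheme \<Rightarrow> 't set \<Rightarrow> 't graph" where
  "cayley_graph T S =
    \<lparr>vertices = carrier T, edges = {{g, s \<otimes>\<^bsub>T\<^esub> g} | g s. g \<in> carrier T \<and> s \<in> S}\<rparr>"

definition cayley_graph_over :: "('t, 'm) monoid_scheme \<Rightarrow> 't graph \<Rightarrow> bool" where
  "cayley_graph_over T \<Gamma> \<longleftrightarrow>
    (\<exists>S \<subseteq> carrier T. \<one>\<^bsub>T\<^esub> \<notin> S \<and> (\<lambda>s. inv\<^bsub>T\<^esub> s) ` S = S \<and> \<Gamma> = cayley_graph T S)"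


section \<open>Groups acting on graphs\<close>

definition automorphisms :: "'v graph \<Rightarrow> ('v \<Rightarrow> 'v) set" where
  "automorphisms \<Gamma> =
    {f \<in> Bij (vertices \<Gamma>).
       \<forall>u \<in> vertices \<Gamma>. \<forall>v \<in> vertices \<Gamma>. (u, v) \<in> adj \<Gamma> \<longleftrightarrow> (f u, f v) \<in> adj \<Gamma>}"

definition aut_group :: "'v graph \<Rightarrow> ('v \<Rightarrow> 'v) monoid" where
  "aut_group \<Gamma> = (BijGroup (vertices \<Gamma>))\<lparr>carrier := automorphisms \<Gamma>\<rparr>"

text \<open>The group structure of a set \<open>G\<close> of permutations of \<open>V\<close>. Its natural action is \<open>\<lambda>g. g\<close>.\<close>

definition perm_group :: "'v set \<Rightarrow> ('v \<Rightarrow> 'v) set \<Rightarrow> ('v \<Rightarrow> 'v) monoid" where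
  "perm_group V G = (BijGroup V)\<lparr>carrier := G\<rparr>"

text \<open>A group \<open>K\<close> acting on the vertices through \<open>\<phi>\<close>; for \<open>i\<close> exceeding the diameter the last
  condition is vacuous.\<close>

definition distance_transitive ::
  "('k, 'm) monoid_scheme \<Rightarrow> ('k \<Rightarrow> 'v \<Rightarrow> 'v) \<Rightarrow> nat \<Rightarrow> 'v graph \<Rightarrow> bool" where
  "distance_transitive K \<phi> s \<Gamma> \<longleftrightarrow>
    transitive_action K (vertices \<Gamma>) \<phi> \<and>
    \<phi> ` carrier K \<subseteq> automorphisms \<Gamma> \<and>
    (\<forall>i \<in> {1..s}. \<forall>u v u' v'. at_distance \<Gamma> i u v \<longrightarrow> at_distance \<Gamma> i u' v' \<longrightarrow>
       (\<exists>g \<in> carrier K. \<phi> g u = u' \<and> \<phi> g v = v'))"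

definition quasiprimitive ::
  "('k, 'm) monoid_scheme \<Rightarrow> 'v set \<Rightarrow> ('k \<Rightarrow> 'v \<Rightarrow> 'v) \<Rightarrow> bool" where
  "quasiprimitive K V \<phi> \<longleftrightarrow>
    faithful_action K V \<phi> \<and> transitive_action K V \<phi> \<and>
    (\<forall>M. M \<lhd> K \<and> M \<noteq> {\<one>\<^bsub>K\<^esub>} \<longrightarrow> transitive_action (K\<lparr>carrier := M\<rparr>) V \<phi>)"

definition biquasiprimitive ::
  "('k, 'm) monoid_scheme \<Rightarrow> 'v set \<Rightarrow> ('k \<Rightarrow> 'v \<Rightarrow> 'v) \<Rightarrow> bool" where
  "biquasiprimitive K V \<phi> \<longleftrightarrow>
    faithful_action K V \<phi> \<and> transitive_action K V \<phi> \<and>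
    (\<forall>M. M \<lhd> K \<and> M \<noteq> {\<one>\<^bsub>K\<^esub>} \<longrightarrow> card (orbits (K\<lparr>carrier := M\<rparr>) V \<phi>) \<le> 2) \<and>
    (\<exists>M. M \<lhd> K \<and> card (orbits (K\<lparr>carrier := M\<rparr>) V \<phi>) = 2)"

definition perm_orbits :: "'v set \<Rightarrow> ('v \<Rightarrow> 'v) set \<Rightarrow> 'v set set" where
  "perm_orbits V N = orbits (perm_group V N) V (\<lambda>g. g)"

definition maximal_normal_ge3_orbits ::
  "'v set \<Rightarrow> ('v \<Rightarrow> 'v) set \<Rightarrow> ('v \<Rightarrow> 'v) set \<Rightarrow> bool" where
  "maximal_normal_ge3_orbits V G N \<longleftrightarrow>
    N \<lhd> perm_group V G \<and> card (perm_orbits V N) \<ge> 3 \<and>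
    (\<forall>M. M \<lhd> perm_group V G \<and> card (perm_orbits V M) \<ge> 3 \<and> N \<subseteq> M \<longrightarrow> M = N)"

definition quotient_graph :: "'v graph \<Rightarrow> ('v \<Rightarrow> 'v) set \<Rightarrow> 'v set graph" where
  "quotient_graph \<Gamma> N =
    \<lparr>vertices = perm_orbits (vertices \<Gamma>) N,
     edges = {{B, C} | B C. B \<in> perm_orbits (vertices \<Gamma>) N \<and> C \<in> perm_orbits (vertices \<Gamma>) N \<and>
                B \<noteq> C \<and> (\<exists>u \<in> B. \<exists>v \<in> C. (u, v) \<in> adj \<Gamma>)}\<rparr>"

definition cover_of_quotient :: "'v graph \<Rightarrow> ('v \<Rightarrow> 'v) set \<Rightarrow> bool" where
  "cover_of_quotient \<Gamma> N \<longleftrightarrow>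
    (\<forall>B C. (B, C) \<in> adj (quotient_graph \<Gamma> N) \<longrightarrow> (\<forall>u \<in> B. \<exists>!v. v \<in> C \<and> (u, v) \<in> adj \<Gamma>))"

text \<open>The action of \<open>G/N\<close> on the \<open>N\<close>-orbits: the elements of a coset of \<open>N\<close> all map a given
  \<open>N\<close>-orbit onto the same \<open>N\<close>-orbit, so the union is the image under any one of them.\<close>

definition quotient_action ::
  "'v set \<Rightarrow> ('v \<Rightarrow> 'v) set \<Rightarrow> ('v \<Rightarrow> 'v) set \<Rightarrow> 'v set \<Rightarrow> 'v set" where
  "quotient_action V N c = (\<lambda>B \<in> perm_orbits V N. \<Union>g\<in>c. g ` B)"

definition right_mult :: "('t, 'm) monoid_scheme \<Rightarrow> 't \<Rightarrow> 't \<Rightarrow> 't" where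
  "right_mult T t = (\<lambda>x \<in> carrier T. x \<otimes>\<^bsub>T\<^esub> t)"

end

theory Submission
  imports Defs Complex_Main
begin

text \<open>If a vertex had two neighbours in one \<open>N\<close>-orbit, then all pairs of vertices at distance 2 would
  lie in common \<open>N\<close>-orbits, which forces \<open>\<Gamma>\<close> to be complete multipartite. So \<open>\<Gamma>\<close> covers the quotient
  graph, and by connectedness an element of \<open>G\<close> that fixes a vertex and all \<open>N\<close>-orbits is trivial.
  The \<open>N\<close>-orbits are the cosets \<open>H x\<close> of a subgroup \<open>H\<close> of \<open>T\<close>. By connectedness the connection set
  contains some \<open>s = a\<^sup>k b\<close>; its inverse is \<open>a\<^sup>-\<^sup>n s\<close>, so the covering property gives
  \<open>a\<^sup>n \<notin> H\<close>. As every \<open>a\<^sup>k b\<close> has square \<open>a\<^sup>n\<close>, this yields \<open>H = \<langle>a\<^sup>i\<rangle>\<close> where \<open>i\<close> divides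
  \<open>2 n\<close> but not \<open>n\<close>. In particular \<open>H\<close> is normal in \<open>T\<close>, its right multiplications fix all
  \<open>N\<close>-orbits, and thus they form \<open>N\<close>. Since \<open>i\<close> does not divide \<open>n\<close>, only the cyclic and the quaternion
  quotient occur.\<close>

section \<open>Presented groups\<close>

fun letter_value :: "('k, 'm) monoid_scheme \<Rightarrow> ('g \<Rightarrow> 'k) \<Rightarrow> 'g letter \<Rightarrow> 'k" where
  "letter_value K f (Pos g) = f g"
| "letter_value K f (Neg g) = inv\<^bsub>K\<^esub> (f g)"

text \<open>The homomorphism from the free group that extends \<open>f\<close>, computed on
  unreduced words.\<close>

definition word_value :: "('k, 'm) monoid_scheme \<Rightarrow> ('g \<Rightarrow> 'k) \<Rightarrow> 'g word \<Rightarrow> 'k" where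
  "word_value K f w = foldr (\<lambda>l t. letter_value K f l \<otimes>\<^bsub>K\<^esub> t) w \<one>\<^bsub>K\<^esub>"

lemma word_value_Nil [simp]: "word_value K f [] = \<one>\<^bsub>K\<^esub>"
  and word_value_Cons [simp]:
    "word_value K f (l # w) = letter_value K f l \<otimes>\<^bsub>K\<^esub> word_value K f w"
  by (simp_all add: word_value_def)

context group
begin

lemma letter_value_closed [simp]: "range f \<subseteq> carrier G \<Longrightarrow> letter_value G f l \<in> carrier G"
  by (cases l) auto

lemma word_value_closed [simp]: "range f \<subseteq> carrier G \<Longrightarrow> word_value G f w \<in> carrier G"
  by (induction w) auto

lemma word_value_append:
  "range f \<subseteq> carrier G \<Longrightarrow> word_value G f (u @ v) = word_value G f u \<otimes> word_value G f v"
  by (induction u) (auto simp: m_assoc)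

lemma word_value_replicate:
  "range f \<subseteq> carrier G \<Longrightarrow> word_value G f (replicate k (Pos g)) = f g [^] k"
  by (induction k) (auto simp: nat_pow_Suc2 [symmetric] range_subsetD simp del: nat_pow_Suc)

text \<open>Every rule generating \<open>word_eq\<close> preserves values: the relations do so by
  hypothesis, and a letter next to its inverse evaluates to the identity. Evaluation therefore
  factors through the presented group.\<close>

lemma word_value_cong:
  assumes f: "range f \<subseteq> carrier G"
    and R: "\<And>l r. (l, r) \<in> R \<Longrightarrow> word_value G f l = word_value G f r"
    and "word_eq R u v"
  shows "word_value G f u = word_value G f v"
  using assms(3)
proof induction
  case (cancel_pos_neg u x v)
  have "f x \<in> carrier G" using f by blast
  then show ?case using f by (simp add: word_value_append m_assoc [symmetric])
next
  case (cancel_neg_pos u x v)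
  have "f x \<in> carrier G" using f by blast
  then show ?case using f by (simp add: word_value_append m_assoc [symmetric])
qed (use f R in \<open>auto simp: word_value_append\<close>)

end

text \<open>Each rule of \<open>word_eq\<close> is stable under enlarging its context, so one factor
  can be rewritten while the other stays fixed; transitivity joins the two rewritings.\<close>

lemma word_eq_append:
  assumes "word_eq R u u'" and "word_eq R v v'"
  shows "word_eq R (u @ v) (u' @ v')"
proof -
  have "word_eq R (p @ u @ q) (p @ u' @ q)" if "word_eq R u u'" for p q u u'
    using that
  proof induction
    case (relation l r u v)
    show ?case using word_eq.relation [OF relation, of "p @ u" "v @ q"] by simp
  next
    case (cancel_pos_neg u x v)
    show ?case using word_eq.cancel_pos_neg [of R "p @ u" x "v @ q"] by simp
  next
    case (cancel_neg_pos u x v)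
    show ?case using word_eq.cancel_neg_pos [of R "p @ u" x "v @ q"] by simp
  qed (auto intro: word_eq.intros)
  from this [of u u' "[]" v] this [of v v' u' "[]"] show ?thesis
    using assms by (auto intro: word_eq.trans)
qed

lemma word_class_eq_iff: "word_class R u = word_class R v \<longleftrightarrow> word_eq R u v"
  unfolding word_class_def
  by (auto intro: word_eq.refl word_eq.sym word_eq.trans)

lemma mem_word_class: "v \<in> word_class R u \<longleftrightarrow> word_class R u = word_class R v"
  by (subst word_class_eq_iff) (simp add: word_class_def)

text \<open>The product of two classes is a union over representatives. By congruence all sets in
  this union are one and the same class, so it collapses.\<close>

lemma mult_presented_group [simp]:
  "word_class R u \<otimes>\<^bsub>presented_group R\<^esub> word_class R v = word_class R (u @ v)"
proof -
  have "word_class R (u' @ v') = word_class R (u @ v)"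
    if "u' \<in> word_class R u" "v' \<in> word_class R v" for u' v'
  proof -
    have "word_eq R (u @ v) (u' @ v')"
      using that by (intro word_eq_append) (simp_all add: word_class_def)
    then show ?thesis by (metis word_class_eq_iff)
  qed
  moreover have "u \<in> word_class R u" "v \<in> word_class R v"
    by (simp_all add: mem_word_class)
  ultimately have "(\<Union>u'\<in>word_class R u. \<Union>v'\<in>word_class R v. word_class R (u' @ v')) = word_class R (u @ v)"
    by blast
  then show ?thesis
    by (simp add: presented_group_def)
qed

lemma one_presented_group: "\<one>\<^bsub>presented_group R\<^esub> = word_class R []"
  and carrier_presented_group: "carrier (presented_group R) = range (word_class R)"
  by (simp_all add: presented_group_def)

fun flip_letter :: "'g letter \<Rightarrow> 'g letter" where
  "flip_letter (Pos g) = Neg g"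
| "flip_letter (Neg g) = Pos g"

text \<open>This supplies inverses: the letters cancel in pairs from the middle outwards.\<close>

lemma word_eq_inverse: "word_eq R (rev (map flip_letter w) @ w) []"
proof (induction w)
  case (Cons l w)
  have "word_eq R (rev (map flip_letter w) @ [flip_letter l, l] @ w) (rev (map flip_letter w) @ w)"
    by (cases l) (auto intro: word_eq.cancel_neg_pos [simplified] word_eq.cancel_pos_neg [simplified])
  then show ?case using Cons by (auto intro: word_eq.trans)
qed (simp add: word_eq.refl)

lemma group_presented_group: "group (presented_group R)"
proof (rule groupI)
  fix x assume "x \<in> carrier (presented_group R)"
  then obtain w where "x = word_class R w" by (auto simp: carrier_presented_group)
  then have "word_class R (rev (map flip_letter w)) \<otimes>\<^bsub>presented_group R\<^esub> x = \<one>\<^bsub>presented_group R\<^esub>"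
    by (simp add: one_presented_group word_class_eq_iff word_eq_inverse)
  then show "\<exists>y\<in>carrier (presented_group R). y \<otimes>\<^bsub>presented_group R\<^esub> x = \<one>\<^bsub>presented_group R\<^esub>"
    by (auto simp: carrier_presented_group)
qed (auto simp: carrier_presented_group one_presented_group)

section \<open>Homomorphisms out of a group presented by two generators\<close>

definition gen_map :: "'k \<Rightarrow> 'k \<Rightarrow> gen \<Rightarrow> 'k" where
  "gen_map x y g = (case g of GenX \<Rightarrow> x | GenY \<Rightarrow> y)"

lemma gen_map_simps [simp]: "gen_map x y GenX = x" "gen_map x y GenY = y"
  by (simp_all add: gen_map_def)

lemma range_gen_map [simp]: "range (gen_map x y) \<subseteq> A \<longleftrightarrow> x \<in> A \<and> y \<in> A"
  by (auto simp: gen_map_def image_subset_iff split: gen.splits)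

lemma presented_by_self:
  "presented_by (presented_group R) (word_class R [Pos GenX]) (word_class R [Pos GenY]) R"
  unfolding presented_by_def
  by (rule bexI [where x = "\<lambda>x. x"]) (auto simp: iso_def hom_def bij_betw_def)

text \<open>The isomorphism and evaluation agree on single letters, and both turn concatenation into
  multiplication. Statements about classes thus become statements about words in
  \<open>T\<close>.\<close>

lemma presented_by_hom:
  assumes "group T" and "presented_by T a b R"
  obtains h where "h \<in> iso (presented_group R) T"
    and "\<And>w. h (word_class R w) = word_value T (gen_map a b) w"
proof -
  interpret P: group "presented_group R" by (rule group_presented_group)
  interpret T: group T by fact
  obtain h where h: "h \<in> iso (presented_group R) T"
    and ab: "h (word_class R [Pos GenX]) = a" "h (word_class R [Pos GenY]) = b"
    using assms(2) by (auto simp: presented_by_def)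
  interpret h: group_hom "presented_group R" T h
    using h by unfold_locales (simp add: iso_def)
  have mem: "word_class R w \<in> carrier (presented_group R)" for w
    by (simp add: carrier_presented_group)
  have pos: "h (word_class R [Pos g]) = gen_map a b g" for g
    using ab by (cases g) auto
  have "h (word_class R [Neg g]) = inv\<^bsub>T\<^esub> (gen_map a b g)" for g
  proof -
    have "word_class R [Neg g] = inv\<^bsub>presented_group R\<^esub> (word_class R [Pos g])"
      by (rule P.inv_equality [symmetric])
        (auto simp: mem one_presented_group word_class_eq_iff
          word_eq.cancel_neg_pos [where u = "[]" and v = "[]", simplified])
    then show ?thesis by (simp add: mem pos)
  qed
  with pos have letter: "h (word_class R [l]) = letter_value T (gen_map a b) l" for l
    by (cases l) auto
  have "h (word_class R w) = word_value T (gen_map a b) w" for w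
  proof (induction w)
    case Nil
    then show ?case using h.hom_one by (simp add: one_presented_group)
  next
    case (Cons l w)
    have "h (word_class R (l # w)) = h (word_class R [l] \<otimes>\<^bsub>presented_group R\<^esub> word_class R w)"
      by simp
    also have "\<dots> = h (word_class R [l]) \<otimes>\<^bsub>T\<^esub> h (word_class R w)"
      by (simp only: h.hom_mult mem)
    finally show ?case using Cons letter by simp
  qed
  with h show thesis by (rule that)
qed

lemma presented_by_relation:
  assumes "group T" and "presented_by T a b R" and "(l, r) \<in> R"
  shows "word_value T (gen_map a b) l = word_value T (gen_map a b) r"
proof -
  obtain h where "\<And>w. h (word_class R w) = word_value T (gen_map a b) w"
    using presented_by_hom assms by metis
  moreover have "word_class R l = word_class R r"
    using word_eq.relation [OF assms(3), of "[]" "[]"] by (simp add: word_class_eq_iff)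
  ultimately show ?thesis by metis
qed

lemma presented_by_carrier:
  assumes "group T" and "presented_by T a b R"
  shows "carrier T = range (word_value T (gen_map a b))"
proof -
  obtain h where "h \<in> iso (presented_group R) T"
    and "\<And>w. h (word_class R w) = word_value T (gen_map a b) w"
    using presented_by_hom assms by metis
  then show ?thesis
    by (auto simp: iso_def bij_betw_def carrier_presented_group image_image image_iff)
qed

lemma presented_by_generators:
  assumes "group T" and "presented_by T a b R"
  shows "a \<in> carrier T" and "b \<in> carrier T"
proof -
  obtain h where h: "h \<in> iso (presented_group R) T"
      "h (word_class R [Pos GenX]) = a" "h (word_class R [Pos GenY]) = b"
    using assms(2) by (auto simp: presented_by_def)
  have "h (word_class R w) \<in> carrier T" for w
    using h(1) by (auto simp: iso_def hom_def carrier_presented_group Pi_def)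
  then show "a \<in> carrier T" "b \<in> carrier T" using h by metis+
qed

text \<open>Von Dyck's theorem: an element of \<open>T\<close> is sent to the value in
  \<open>K\<close> of a word representing it, and the relations make this independent of the
  word.\<close>

lemma presented_by_universal:
  assumes "group T" and "presented_by T a b R" and "group K"
    and "x \<in> carrier K" and "y \<in> carrier K"
    and R: "\<And>l r. (l, r) \<in> R \<Longrightarrow> word_value K (gen_map x y) l = word_value K (gen_map x y) r"
  obtains f where "f \<in> hom T K" and "f a = x" and "f b = y"
proof -
  interpret T: group T by fact
  interpret K: group K by fact
  obtain h where h: "h \<in> iso (presented_group R) T"
    and val: "\<And>w. h (word_class R w) = word_value T (gen_map a b) w"
    using presented_by_hom assms(1,2) by metis
  note ab = presented_by_generators [OF assms(1,2)]
  define f where "f t = word_value K (gen_map x y) (SOME w. word_value T (gen_map a b) w = t)" for t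
  have f: "f (word_value T (gen_map a b) w) = word_value K (gen_map x y) w" for w
  proof -
    define v where "v = (SOME v. word_value T (gen_map a b) v = word_value T (gen_map a b) w)"
    have "word_value T (gen_map a b) v = word_value T (gen_map a b) w"
      unfolding v_def by (rule someI [where x = w]) simp
    \<comment> \<open>Injectivity of \<open>h\<close> turns equal values in \<open>T\<close> into
      equivalent words, to which \<open>word_value_cong\<close> applies in \<open>K\<close>.\<close>
    then have "h (word_class R v) = h (word_class R w)" by (simp add: val)
    moreover have "inj_on h (range (word_class R))"
      using h by (simp add: iso_def bij_betw_def carrier_presented_group)
    ultimately have "word_class R v = word_class R w"
      by (auto dest: inj_onD)
    then have "word_eq R v w"
      by (simp add: word_class_eq_iff)
    then have "word_value K (gen_map x y) v = word_value K (gen_map x y) w"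
      using K.word_value_cong [of "gen_map x y" R v w] R assms(4,5) by simp
    then show ?thesis unfolding f_def v_def .
  qed
  show thesis
  proof
    show "f \<in> hom T K"
    proof (rule homI)
      fix s t assume "s \<in> carrier T" "t \<in> carrier T"
      then obtain u v where uv: "s = word_value T (gen_map a b) u" "t = word_value T (gen_map a b) v"
        using presented_by_carrier [OF assms(1,2)] by auto
      have "s \<otimes>\<^bsub>T\<^esub> t = word_value T (gen_map a b) (u @ v)"
        using ab by (simp add: T.word_value_append uv)
      then show "f (s \<otimes>\<^bsub>T\<^esub> t) = f s \<otimes>\<^bsub>K\<^esub> f t"
        using assms(4,5) by (simp add: f uv K.word_value_append)
    next
      fix t assume "t \<in> carrier T"
      then show "f t \<in> carrier K"
        using presented_by_carrier [OF assms(1,2)] assms(4,5) f by auto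
    qed
    show "f a = x" using f [of "[Pos GenX]"] ab assms by simp
    show "f b = y" using f [of "[Pos GenY]"] ab assms by simp
  qed
qed

section \<open>Generalized quaternion groups\<close>

text \<open>The conjugation relation takes the inverse-free form x y x = y, which is convenient to
  check in concrete groups.\<close>

definition quaternion_pair :: "('k, 'm) monoid_scheme \<Rightarrow> nat \<Rightarrow> 'k \<Rightarrow> 'k \<Rightarrow> bool" where
  "quaternion_pair K m x y \<longleftrightarrow> x \<in> carrier K \<and> y \<in> carrier K \<and>
    x [^]\<^bsub>K\<^esub> (2 * m) = \<one>\<^bsub>K\<^esub> \<and> y \<otimes>\<^bsub>K\<^esub> y = x [^]\<^bsub>K\<^esub> m \<and> x \<otimes>\<^bsub>K\<^esub> y \<otimes>\<^bsub>K\<^esub> x = y"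

lemma (in group) quaternion_pair_iff:
  assumes "x \<in> carrier G" and "y \<in> carrier G"
  shows "(\<forall>(l, r) \<in> quaternion_relations m. word_value G (gen_map x y) l = word_value G (gen_map x y) r)
    \<longleftrightarrow> quaternion_pair G m x y"
proof -
  have "inv y \<otimes> (x \<otimes> y) = inv x \<longleftrightarrow> x \<otimes> y \<otimes> x = y"
  proof
    assume "inv y \<otimes> (x \<otimes> y) = inv x"
    then have "x \<otimes> y = y \<otimes> inv x" using assms by (simp add: inv_solve_left')
    then show "x \<otimes> y \<otimes> x = y" using assms by (simp add: m_assoc)
  next
    assume "x \<otimes> y \<otimes> x = y"
    then have "inv y \<otimes> (x \<otimes> y \<otimes> x) \<otimes> inv x = inv y \<otimes> y \<otimes> inv x" by simp
    then show "inv y \<otimes> (x \<otimes> y) = inv x" using assms by (simp add: m_assoc)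
  qed
  then show ?thesis
    using assms by (auto simp: quaternion_relations_def quaternion_pair_def word_value_replicate)
qed

text \<open>The relations do not show directly that \<open>a [^] n\<close> is nontrivial; a concrete
  pair satisfying them does. It consists of the matrices diag(zeta, conjugate of zeta) and ((0, -1),
  (1, 0)), acting on pairs of complex numbers.\<close>

lemma quaternion_complex_model:
  fixes n :: nat
  assumes "n \<ge> 1"
  obtains K :: "(complex \<times> complex \<Rightarrow> complex \<times> complex) monoid" and x y
  where "group K" and "quaternion_pair K n x y" and "x [^]\<^bsub>K\<^esub> n \<noteq> \<one>\<^bsub>K\<^esub>"
proof
  define K :: "(complex \<times> complex \<Rightarrow> complex \<times> complex) monoid" where "K = BijGroup UNIV"
  \<comment> \<open>A primitive 2n-th root of unity, so that \<open>x [^] n\<close> is minus the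
    identity.\<close>
  define \<zeta> where "\<zeta> = cis (pi / n)"
  define x where "x = (\<lambda>(u :: complex, v :: complex). (\<zeta> * u, cnj \<zeta> * v))"
  define y where "y = (\<lambda>(u :: complex, v :: complex). (- v, u))"
  show "group (BijGroup UNIV :: (complex \<times> complex \<Rightarrow> complex \<times> complex) monoid)"
    by (rule group_BijGroup)
  then interpret K: group K by (simp add: K_def)
  have \<zeta>: "\<zeta> * cnj \<zeta> = 1" "cnj \<zeta> * \<zeta> = 1"
    by (simp_all add: \<zeta>_def cis_cnj cis_mult)
  have car: "f \<in> carrier K \<longleftrightarrow> bij f" for f
    by (simp add: K_def BijGroup_def Bij_def extensional_def)
  have mult: "f \<otimes>\<^bsub>K\<^esub> g = f \<circ> g" if "bij f" "bij g" for f g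
    using that by (simp add: K_def BijGroup_def Bij_def extensional_def compose_def fun_eq_iff)
  have one: "\<one>\<^bsub>K\<^esub> = id"
    by (simp add: K_def BijGroup_def fun_eq_iff)
  have "bij x"
    by (rule o_bij [where g = "\<lambda>(u, v). (cnj \<zeta> * u, \<zeta> * v)"])
      (auto simp: x_def fun_eq_iff mult.assoc [symmetric] \<zeta>)
  have "bij y"
    by (rule o_bij [where g = "\<lambda>(u, v). (v, - u)"]) (auto simp: y_def fun_eq_iff)
  have pow: "bij (x [^]\<^bsub>K\<^esub> k) \<and> x [^]\<^bsub>K\<^esub> k = (\<lambda>(u, v). (\<zeta> ^ k * u, cnj \<zeta> ^ k * v))" for k :: nat
  proof (induction k)
    case (Suc k)
    then have "x [^]\<^bsub>K\<^esub> Suc k = (x [^]\<^bsub>K\<^esub> k) \<circ> x" using mult [OF _ \<open>bij x\<close>] by (metis K.nat_pow_Suc)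
    moreover have "bij ((x [^]\<^bsub>K\<^esub> k) \<circ> x)" using Suc \<open>bij x\<close> bij_comp by blast
    ultimately show ?case using Suc by (simp only:) (auto simp: x_def fun_eq_iff)
  qed (auto simp: one fun_eq_iff bij_id [unfolded id_def])
  have "\<zeta> ^ n = -1"
    using assms by (simp add: \<zeta>_def DeMoivre)
  moreover from this have "cnj \<zeta> ^ n = -1"
    by (simp flip: complex_cnj_power)
  ultimately have xn: "x [^]\<^bsub>K\<^esub> n = (\<lambda>(u, v). (- u, - v))" and "\<zeta> ^ (2 * n) = 1" "cnj \<zeta> ^ (2 * n) = 1"
    using pow [of n] by (simp_all add: mult.commute [of 2] power_mult)
  then have "x [^]\<^bsub>K\<^esub> (2 * n) = \<one>\<^bsub>K\<^esub>"
    using pow [of "2 * n"] by (auto simp: one fun_eq_iff)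
  moreover have "y \<otimes>\<^bsub>K\<^esub> y = x [^]\<^bsub>K\<^esub> n"
    unfolding mult [OF \<open>bij y\<close> \<open>bij y\<close>] xn by (auto simp: y_def fun_eq_iff)
  moreover have "x \<otimes>\<^bsub>K\<^esub> y \<otimes>\<^bsub>K\<^esub> x = y"
    using \<open>bij x\<close> \<open>bij y\<close> \<zeta>
    by (auto simp: mult bij_comp x_def y_def fun_eq_iff mult.assoc [symmetric])
  ultimately show "quaternion_pair (BijGroup UNIV) n x y"
    using car \<open>bij x\<close> \<open>bij y\<close> by (simp add: quaternion_pair_def K_def)
  show "x [^]\<^bsub>BijGroup UNIV\<^esub> n \<noteq> \<one>\<^bsub>BijGroup UNIV\<^esub>"
    using xn unfolding one [unfolded K_def] K_def by (auto simp: fun_eq_iff intro: exI [of _ 1])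
qed

section \<open>Normal form and subgroups of a generalized quaternion group\<close>

locale quaternion_presentation = group T for T (structure) +
  fixes a b :: 'a and n :: nat
  assumes presented: "presented_by T a b (quaternion_relations n)"
begin

lemma a_closed [simp]: "a \<in> carrier T" and b_closed [simp]: "b \<in> carrier T"
  using presented_by_generators [OF is_group presented] by auto

lemma quaternion_pair_ab: "quaternion_pair T n a b"
  using presented_by_relation [OF is_group presented] quaternion_pair_iff [of a b n] by fastforce

lemma a_pow_2n: "a [^] (2 * n) = \<one>" and b_square: "b \<otimes> b = a [^] n" and a_b_a: "a \<otimes> b \<otimes> a = b"
  using quaternion_pair_ab by (auto simp: quaternion_pair_def)

lemma quaternion_universal:
  assumes "group K" and "quaternion_pair K n x y"
  obtains f where "group_hom T K f" and "f a = x" and "f b = y"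
proof -
  interpret K: group K by fact
  have xy: "x \<in> carrier K" "y \<in> carrier K"
    using assms(2) by (auto simp: quaternion_pair_def)
  have "\<And>l r. (l, r) \<in> quaternion_relations n \<Longrightarrow>
      word_value K (gen_map x y) l = word_value K (gen_map x y) r"
    using K.quaternion_pair_iff [OF xy, of n] assms(2) by auto
  then obtain f where "f \<in> hom T K" "f a = x" "f b = y"
    using presented_by_universal [OF is_group presented assms(1) xy] by metis
  moreover from this have "group_hom T K f"
    by unfold_locales
  ultimately show thesis using that by blast
qed

text \<open>Conjugation by \<open>b\<close> inverts \<open>a\<close>. Natural exponents follow by
  induction, negative ones by solving the same equation for the other side.\<close>

lemma b_mult_a_pow: "b \<otimes> a [^] (k :: int) = a [^] (- k) \<otimes> b"
proof -
  have 1: "b \<otimes> a = inv a \<otimes> b"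
    using a_b_a by (simp add: inv_solve_left m_assoc [symmetric])
  have nat: "b \<otimes> a [^] k = inv (a [^] k) \<otimes> b" for k :: nat
  proof (induction k)
    case (Suc k)
    have "b \<otimes> a [^] Suc k = inv (a [^] k) \<otimes> (b \<otimes> a)"
      using Suc by (simp add: m_assoc [symmetric])
    also have "\<dots> = inv (a \<otimes> a [^] k) \<otimes> b"
      by (simp add: 1 m_assoc [symmetric] inv_mult_group)
    finally show ?case by (simp flip: nat_pow_Suc2)
  qed simp
  show ?thesis
  proof (cases k rule: int_cases2)
    case (nonneg m)
    then show ?thesis using nat [of m] by (simp add: int_pow_neg int_pow_int)
  next
    case (nonpos m)
    have "a [^] m \<otimes> (b \<otimes> a [^] m) = b" using nat [of m] by (simp add: m_assoc [symmetric])
    then have "b = a [^] m \<otimes> b \<otimes> a [^] m" by (simp add: m_assoc)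
    then have "b \<otimes> inv (a [^] m) = a [^] m \<otimes> b"
      by (simp add: inv_solve_right')
    then show ?thesis using nonpos by (simp add: int_pow_neg int_pow_int)
  qed
qed

text \<open>Moving \<open>b\<close> past the power of \<open>a\<close> inverts that power, so the
  powers cancel and \<open>b \<otimes> b\<close> remains. All elements outside the cyclic subgroup
  thus share one square.\<close>

lemma square_a_pow_b: "(a [^] (k :: int) \<otimes> b) \<otimes> (a [^] k \<otimes> b) = a [^] n"
proof -
  have "(a [^] k \<otimes> b) \<otimes> (a [^] k \<otimes> b) = a [^] k \<otimes> (b \<otimes> a [^] k) \<otimes> b"
    by (simp add: m_assoc)
  also have "\<dots> = (a [^] k \<otimes> a [^] (- k)) \<otimes> (b \<otimes> b)"
    by (simp add: b_mult_a_pow m_assoc)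
  finally show ?thesis by (simp add: b_square int_pow_neg)
qed

text \<open>The set \<open>M\<close> of elements in normal form contains the identity and is closed
  under left multiplication by the generators and their inverses, so it contains the value of every
  word.\<close>

lemma element_cases:
  assumes "t \<in> carrier T"
  obtains k :: int where "t = a [^] k" | k :: int where "t = a [^] k \<otimes> b"
proof -
  define M where "M = range (\<lambda>k :: int. a [^] k) \<union> range (\<lambda>k :: int. a [^] k \<otimes> b)"
  have a_pow: "a [^] k \<otimes> t \<in> M" if "t \<in> M" for k :: int and t
    using that by (auto simp: M_def m_assoc [symmetric] int_pow_mult [symmetric])
  have b_mult: "b \<otimes> t \<in> M" if "t \<in> M" for t
  proof -
    have "b \<otimes> (a [^] k \<otimes> b) = a [^] (int n - k)" for k :: int
    proof -
      have "b \<otimes> (a [^] k \<otimes> b) = a [^] (- k) \<otimes> (b \<otimes> b)"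
        by (simp add: m_assoc [symmetric] b_mult_a_pow)
      also have "\<dots> = a [^] (int n - k)"
        by (simp add: b_square int_pow_int [symmetric] int_pow_mult [symmetric])
      finally show ?thesis .
    qed
    then show ?thesis using that by (auto simp: M_def b_mult_a_pow)
  qed
  \<comment> \<open>Since \<open>b \<otimes> b = a [^] n\<close>, multiplying by
    \<open>inv b\<close> reduces to multiplying by \<open>b\<close> and by a power of
    \<open>a\<close>.\<close>
  have inv_b: "inv b = a [^] (- int n) \<otimes> b"
    by (rule inv_equality) (simp_all add: m_assoc b_square int_pow_int int_pow_neg)
  have "letter_value T (gen_map a b) l \<otimes> t \<in> M" if "t \<in> M" for l t
  proof -
    have "t \<in> carrier T" using that by (auto simp: M_def)
    then have "inv b \<otimes> t = a [^] (- int n) \<otimes> (b \<otimes> t)" by (simp add: inv_b m_assoc)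
    moreover have "a = a [^] (1 :: int)" "inv a = a [^] (-1 :: int)" by (simp_all add: int_pow_neg)
    ultimately have "a \<otimes> t \<in> M" "inv a \<otimes> t \<in> M" "b \<otimes> t \<in> M" "inv b \<otimes> t \<in> M"
      using that a_pow b_mult by metis+
    then show ?thesis
      by (cases l; rename_tac g; case_tac g) simp_all
  qed
  moreover have "\<one> \<in> M" by (auto simp: M_def image_iff intro: exI [of _ "0 :: int"])
  ultimately have "word_value T (gen_map a b) w \<in> M" for w
    by (induction w) auto
  then have "t \<in> M" using assms presented_by_carrier [OF is_group presented] by auto
  then show thesis using that by (auto simp: M_def)
qed

text \<open>Otherwise its image \<open>x [^] n\<close> in the complex model would be trivial as
  well.\<close>

lemma a_pow_n_neq_one: "n \<ge> 1 \<Longrightarrow> a [^] n \<noteq> \<one>"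
proof
  assume "n \<ge> 1" "a [^] n = \<one>"
  obtain K :: "(complex \<times> complex \<Rightarrow> complex \<times> complex) monoid" and x y
    where K: "group K" "quaternion_pair K n x y" "x [^]\<^bsub>K\<^esub> n \<noteq> \<one>\<^bsub>K\<^esub>"
    using quaternion_complex_model \<open>n \<ge> 1\<close> by metis
  obtain f where f: "group_hom T K f" "f a = x"
    using quaternion_universal K by metis
  then show False
    using \<open>a [^] n = \<one>\<close> group_hom.hom_nat_pow [OF f(1), of a n] group_hom.hom_one [OF f(1)] K(3) by simp
qed

text \<open>The homomorphism to the integers modulo 2 that kills \<open>a\<close> and sends
  \<open>b\<close> to 1 separates \<open>b\<close> from the powers of \<open>a\<close>.\<close>

lemma b_neq_a_pow: "b \<noteq> a [^] (k :: int)"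
proof
  assume b: "b = a [^] k"
  have "quaternion_pair (integer_mod_group 2) n 0 1"
    by (auto simp: quaternion_pair_def)
  then obtain f where f: "group_hom T (integer_mod_group 2) f" "f a = 0" "f b = 1"
    using quaternion_universal [OF group_integer_mod_group] by metis
  then have "f b = 0"
    using b group_hom.hom_int_pow [OF f(1), of a k] by (simp add: int_pow_integer_mod_group)
  with f(3) show False by simp
qed

text \<open>An element of \<open>H\<close> of the form \<open>a [^] k \<otimes> b\<close> would have
  the square \<open>a [^] n\<close>, which is excluded. So \<open>H\<close> is cyclic, generated by
  its power of \<open>a\<close> with least positive exponent.\<close>

lemma subgroup_a_powers:
  assumes H: "subgroup H T" and "a [^] n \<notin> H"
  obtains i :: nat where "i > 0" and "i dvd 2 * n" and "\<not> i dvd n" and "H = generate T {a [^] i}"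
proof -
  have cyc: "\<exists>k :: int. t = a [^] k" if "t \<in> H" for t
  proof -
    have "t \<in> carrier T" using H that subgroup.mem_carrier by metis
    then show ?thesis
    proof (cases rule: element_cases)
      case (2 k)
      have "t \<otimes> t \<in> H" using H that by (simp add: subgroup.m_closed)
      then show ?thesis using 2 square_a_pow_b assms(2) by simp
    qed auto
  qed
  have "n > 0"
    using assms(2) H subgroup.one_closed by (cases n) auto
  define i :: nat where "i = (LEAST i. i > 0 \<and> a [^] i \<in> H)"
  have "2 * n > 0 \<and> a [^] (2 * n) \<in> H"
    unfolding a_pow_2n using \<open>n > 0\<close> H subgroup.one_closed by auto
  then have i: "i > 0" "a [^] i \<in> H"
    using LeastI [of "\<lambda>i :: nat. i > 0 \<and> a [^] i \<in> H" "2 * n"] unfolding i_def by auto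
  have least: "i \<le> j" if "j > 0" "a [^] j \<in> H" for j
    unfolding i_def using that by (intro Least_le) auto
  have gen: "generate T {a [^] i} = range (\<lambda>k :: int. a [^] (int i * k))"
    using generate_pow [of "a [^] i"] by (auto simp: int_pow_int [symmetric] int_pow_pow)
  have pow_iff: "a [^] k \<in> H \<longleftrightarrow> int i dvd k" for k :: int
  proof
    assume k: "a [^] k \<in> H"
    \<comment> \<open>Division with remainder in the exponent: the remainder is smaller than
      \<open>i\<close> and its power lies in \<open>H\<close>, so it vanishes by minimality.\<close>
    have "(a [^] int i) [^] (k div int i) \<in> H"
      using i(2) H by (metis int_pow_int subgroup_int_pow_closed)
    then have "a [^] (int i * (k div int i)) \<in> H"
      by (simp add: int_pow_pow)
    then have "a [^] k \<otimes> inv (a [^] (int i * (k div int i))) \<in> H"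
      using k H subgroup.m_closed subgroup.m_inv_closed by metis
    then have "a [^] (k - int i * (k div int i)) \<in> H"
      by (simp add: int_pow_diff)
    then have "a [^] (k mod int i) \<in> H"
      by (simp add: minus_mult_div_eq_mod)
    then have "a [^] nat (k mod int i) \<in> H"
      using i(1) by (simp add: int_pow_int [symmetric])
    then have "nat (k mod int i) = 0"
      using least [of "nat (k mod int i)"] i(1) by (metis gr0I nat_less_iff of_nat_0_less_iff pos_mod_bound pos_mod_sign not_less)
    then show "int i dvd k"
      using i(1) by (simp add: dvd_eq_mod_eq_0 nat_eq_iff2) (metis of_nat_0_less_iff pos_mod_sign le_less not_less)
  next
    assume "int i dvd k"
    then obtain c where "k = int i * c" by blast
    then have "a [^] k = (a [^] i) [^] c" by (simp add: int_pow_int [symmetric] int_pow_pow)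
    then show "a [^] k \<in> H" using i(2) H by (simp add: subgroup_int_pow_closed)
  qed
  show thesis
  proof
    show "i > 0" by fact
    show "i dvd 2 * n"
      using pow_iff [of "int (2 * n)"] \<open>2 * n > 0 \<and> a [^] (2 * n) \<in> H\<close>
      by (metis int_dvd_int_iff int_pow_int)
    show "\<not> i dvd n"
      using pow_iff [of "int n"] assms(2) by (simp add: int_pow_int)
    show "H = generate T {a [^] i}"
      using cyc pow_iff by (fastforce simp: gen dvd_def)
  qed
qed

text \<open>Powers of \<open>a\<close> centralize the cyclic subgroup, and elements
  \<open>a [^] m \<otimes> b\<close> invert it, so all its subgroups are normal.\<close>

lemma normal_a_powers: "generate T {a [^] (i :: nat)} \<lhd> T"
proof -
  have gen: "generate T {a [^] i} = range (\<lambda>k :: int. a [^] (int i * k))"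
    using generate_pow [of "a [^] i"] by (auto simp: int_pow_int [symmetric] int_pow_pow)
  have "t \<otimes> a [^] (int i * k) \<otimes> inv t \<in> generate T {a [^] i}" if "t \<in> carrier T" for t and k :: int
    using that
  proof (cases rule: element_cases)
    case (1 m)
    have "t \<otimes> a [^] (int i * k) \<otimes> inv t = a [^] (int i * k)"
      by (simp add: 1 int_pow_mult [symmetric] int_pow_neg [symmetric])
    then show ?thesis by (auto simp: gen)
  next
    case (2 m)
    have "t \<otimes> a [^] (int i * k) = a [^] m \<otimes> (b \<otimes> a [^] (int i * k))"
      by (simp add: 2 m_assoc)
    also have "\<dots> = a [^] (m + - (int i * k)) \<otimes> b"
      unfolding b_mult_a_pow by (simp add: m_assoc [symmetric] int_pow_mult [symmetric])
    also have "\<dots> = a [^] (int i * (- k)) \<otimes> t"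
      by (simp add: 2 m_assoc [symmetric] int_pow_mult [symmetric] add.commute)
    finally have "t \<otimes> a [^] (int i * k) \<otimes> inv t = a [^] (int i * (- k))"
      using that by (simp add: m_assoc)
    then show ?thesis unfolding gen by blast
  qed
  then show ?thesis
    unfolding normal_inv_iff using generate_is_subgroup [of "{a [^] i}"] by (auto simp: gen)
qed

section \<open>Quotients by subgroups of the cyclic part\<close>

lemma hom_eq_on_generators:
  assumes f: "group_hom T K f" and g: "group_hom T K g" and "f a = g a" and "f b = g b"
    and t: "t \<in> carrier T"
  shows "f t = g t"
proof -
  interpret f: group_hom T K f by fact
  interpret g: group_hom T K g by fact
  from t show ?thesis
    by (cases rule: element_cases) (simp_all add: assms(3,4) f.hom_int_pow g.hom_int_pow)
qed

text \<open>The universal properties give maps from \<open>T\<close> to the smaller quaternion group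
  and from there to \<open>T Mod A\<close>. Their composite determines the kernel of the first map,
  and the first isomorphism theorem concludes.\<close>

lemma quotient_iso_quaternion:
  assumes "m > 0" and "2 * m dvd 2 * n" and "\<not> 2 * m dvd n"
  shows "T Mod generate T {a [^] (2 * m)} \<cong> generalized_quaternion_group m"
proof -
  define A where "A = generate T {a [^] (2 * m)}"
  interpret A: normal A T unfolding A_def by (rule normal_a_powers)
  interpret TA: group "T Mod A" by (rule A.factorgroup_is_group)
  interpret pr: group_hom T "T Mod A" "\<lambda>t. A #> t"
    by unfold_locales (rule A.r_coset_hom_Mod)
  have amA: "a [^] (2 * m) \<in> A" unfolding A_def by (auto intro: generate.incl)
  define R where "R = quaternion_relations m"
  define x where "x = word_class R [Pos GenX]"
  define y where "y = word_class R [Pos GenY]"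
  interpret Q: quaternion_presentation "presented_group R" x y m
    unfolding quaternion_presentation_def quaternion_presentation_axioms_def x_def y_def R_def
    by (simp add: group_presented_group presented_by_self)
  \<comment> \<open>The hypotheses make \<open>n\<close> an odd multiple of \<open>m\<close>, hence
    congruent to \<open>m\<close> modulo \<open>2 * m\<close>. Therefore the relations for
    \<open>m\<close> imply those for \<open>n\<close>.\<close>
  from assms(2) have "m dvd n" by simp
  then obtain d where "n = m * d" by blast
  with assms(3) have "odd d" by auto
  then obtain c where "d = 2 * c + 1" by (rule oddE)
  with \<open>n = m * d\<close> have n: "n = (2 * m) * c + m" by (simp add: algebra_simps)
  have x_n: "x [^]\<^bsub>presented_group R\<^esub> n = x [^]\<^bsub>presented_group R\<^esub> m"
    unfolding n by (simp add: Q.nat_pow_mult [symmetric] Q.nat_pow_pow [symmetric] Q.a_pow_2n del: mult_presented_group)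
  then have "x [^]\<^bsub>presented_group R\<^esub> (2 * n) = \<one>\<^bsub>presented_group R\<^esub>"
    using Q.a_pow_2n by (simp add: mult_2 Q.nat_pow_mult [symmetric] del: mult_presented_group)
  with x_n have "quaternion_pair (presented_group R) n x y"
    using Q.quaternion_pair_ab by (simp add: quaternion_pair_def)
  then obtain f where f: "group_hom T (presented_group R) f" "f a = x" "f b = y"
    using quaternion_universal Q.is_group by metis
  interpret f: group_hom T "presented_group R" f by fact
  have pow: "(A #> a) [^]\<^bsub>T Mod A\<^esub> k = A #> a [^] k" for k :: nat
    by (simp add: pr.hom_nat_pow)
  have a2m: "(A #> a) [^]\<^bsub>T Mod A\<^esub> (2 * m) = \<one>\<^bsub>T Mod A\<^esub>"
    unfolding pow using amA by (simp add: A.rcos_const is_group)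
  have an: "(A #> a) [^]\<^bsub>T Mod A\<^esub> n = (A #> a) [^]\<^bsub>T Mod A\<^esub> m"
    unfolding n by (simp add: TA.nat_pow_mult [symmetric] TA.nat_pow_pow [symmetric] a2m pr.hom_closed del: mult_FactGroup one_FactGroup)
  have "(A #> b) \<otimes>\<^bsub>T Mod A\<^esub> (A #> b) = (A #> a) [^]\<^bsub>T Mod A\<^esub> n"
    using pr.hom_mult [of b b] pow [of n] b_square by simp
  moreover have "(A #> a) \<otimes>\<^bsub>T Mod A\<^esub> (A #> b) \<otimes>\<^bsub>T Mod A\<^esub> (A #> a) = A #> b"
    using pr.hom_mult [of a b] pr.hom_mult [of "a \<otimes> b" a] a_b_a by simp
  ultimately have "quaternion_pair (T Mod A) m (A #> a) (A #> b)"
    using a2m an pr.hom_closed [of a] pr.hom_closed [of b] unfolding quaternion_pair_def by simp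
  then obtain g where g: "group_hom (presented_group R) (T Mod A) g" "g x = A #> a" "g y = A #> b"
    using Q.quaternion_universal TA.is_group by metis
  have gf: "group_hom T (T Mod A) (g \<circ> f)"
    using Group.hom_compose [OF f.homh group_hom.homh [OF g(1)]]
    by (simp add: group_hom_def group_hom_axioms_def is_group TA.is_group)
  \<comment> \<open>\<open>g \<circ> f\<close> is the projection onto \<open>T Mod A\<close>, so the kernel of \<open>f\<close> is contained in \<open>A\<close>.\<close>
  have "(g \<circ> f) t = A #> t" if "t \<in> carrier T" for t
    by (rule hom_eq_on_generators [OF gf pr.group_hom_axioms _ _ that]) (simp_all add: f g)
  then have "A #> t = A" if "t \<in> carrier T" "f t = \<one>\<^bsub>presented_group R\<^esub>" for t
    using that group_hom.hom_one [OF g(1)] by fastforce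
  then have "kernel T (presented_group R) f \<subseteq> A"
    using rcos_self [OF _ A.subgroup_axioms] by (fastforce simp: kernel_def)
  moreover have "a [^] (2 * m) \<in> kernel T (presented_group R) f"
    using Q.a_pow_2n by (simp add: kernel_def f.hom_nat_pow f(2))
  then have "A \<subseteq> kernel T (presented_group R) f"
    unfolding A_def by (intro generate_subgroup_incl f.subgroup_kernel) auto
  ultimately have ker: "kernel T (presented_group R) f = A" by blast
  have "q \<in> f ` carrier T" if "q \<in> carrier (presented_group R)" for q
    using that
  proof (cases rule: Q.element_cases)
    case (1 k)
    then have "q = f (a [^] k)" by (simp add: f.hom_int_pow f(2))
    then show ?thesis by simp
  next
    case (2 k)
    then have "q = f (a [^] k \<otimes> b)" by (simp add: f.hom_int_pow f(2,3) del: mult_presented_group)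
    then show ?thesis by (metis image_eqI int_pow_closed a_closed b_closed m_closed)
  qed
  then have "f ` carrier T = carrier (presented_group R)" by auto
  then show ?thesis
    using f.FactGroup_iso ker unfolding A_def generalized_quaternion_group_def R_def by simp
qed

text \<open>Send \<open>a\<close> to 2 and \<open>b\<close> to 1. Elements
  \<open>a [^] k \<otimes> b\<close> get odd values, so the kernel consists of the even powers of
  \<open>a\<close>.\<close>

lemma quotient_iso_cyclic4:
  assumes "odd n"
  shows "T Mod generate T {a [^] (2 :: nat)} \<cong> integer_mod_group 4"
proof -
  \<comment> \<open>Oddness of \<open>n\<close> gives the relation for the square of
    \<open>b\<close>: both 1 + 1 and 2n are 2 modulo 4.\<close>
  have "int n * 2 mod 4 = 2" using assms by (auto elim!: oddE simp: algebra_simps)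
  then have "quaternion_pair (integer_mod_group 4) n 2 1"
    by (auto simp: quaternion_pair_def carrier_integer_mod_group)
  then obtain f where f: "group_hom T (integer_mod_group 4) f" "f a = 2" "f b = 1"
    using quaternion_universal [OF group_integer_mod_group] by metis
  interpret f: group_hom T "integer_mod_group 4" f by fact
  have fa: "f (a [^] k) = k * 2 mod 4" for k :: int
    using f.hom_int_pow [of a k] by (simp add: f(2) int_pow_integer_mod_group)
  have fab: "f (a [^] k \<otimes> b) = (k * 2 + 1) mod 4" for k :: int
    using f.hom_mult [of "a [^] k" b] by (simp add: f(3) fa mod_add_left_eq)
  have "kernel T (integer_mod_group 4) f \<subseteq> generate T {a [^] (2 :: nat)}"
  proof
    fix t assume t: "t \<in> kernel T (integer_mod_group 4) f"
    then have "t \<in> carrier T" by (simp add: kernel_def)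
    then show "t \<in> generate T {a [^] (2 :: nat)}"
    proof (cases rule: element_cases)
      case (1 k)
      then have "k * 2 mod 4 = 0" using t fa by (simp add: kernel_def)
      then have "even k" by presburger
      then obtain c where "k = 2 * c" by blast
      then have "t = (a [^] (2 :: nat)) [^] c"
        using 1 by (simp add: int_pow_int [symmetric] int_pow_pow)
      then show ?thesis using generate_pow [of "a [^] (2 :: nat)"] by auto
    next
      case (2 k)
      then have "(k * 2 + 1) mod 4 = 0" using t fab by (simp add: kernel_def)
      then have False by presburger
      then show ?thesis ..
    qed
  qed
  moreover have "a [^] (2 :: nat) \<in> kernel T (integer_mod_group 4) f"
    using fa [of "int 2"] unfolding int_pow_int by (simp add: kernel_def)
  then have "generate T {a [^] (2 :: nat)} \<subseteq> kernel T (integer_mod_group 4) f"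
    by (intro generate_subgroup_incl f.subgroup_kernel) auto
  ultimately have ker: "kernel T (integer_mod_group 4) f = generate T {a [^] (2 :: nat)}" by blast
  have "q \<in> f ` carrier T" if "q \<in> carrier (integer_mod_group 4)" for q
  proof -
    have "q = 0 \<or> q = 1 \<or> q = 2 \<or> q = 3"
      using that by (auto simp: carrier_integer_mod_group)
    \<comment> \<open>The listed images are 0, 1, 2 and 3, in this order.\<close>
    then have "q \<in> {f (a [^] (0 :: int)), f (a [^] (0 :: int) \<otimes> b), f (a [^] (1 :: int)), f (a [^] (1 :: int) \<otimes> b)}"
      unfolding fa fab by auto
    also have "\<dots> \<subseteq> f ` carrier T"
      unfolding insert_subset by (intro conjI imageI empty_subsetI) simp_all
    finally show ?thesis .
  qed
  then have "f ` carrier T = carrier (integer_mod_group 4)" by auto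
  then show ?thesis using f.FactGroup_iso ker by simp
qed

end

section \<open>Normal quotients of 2-distance-transitive graphs\<close>

lemma adj_sym: "(u, v) \<in> adj \<Gamma> \<Longrightarrow> (v, u) \<in> adj \<Gamma>"
  by (simp add: adj_def insert_commute)

lemma finite_simple_graph_adjD:
  assumes "finite_simple_graph \<Gamma>" and "(u, v) \<in> adj \<Gamma>"
  shows "u \<in> vertices \<Gamma>" and "v \<in> vertices \<Gamma>" and "u \<noteq> v"
proof -
  have "{u, v} \<subseteq> vertices \<Gamma>" "card {u, v} = 2"
    using assms by (auto simp: finite_simple_graph_def adj_def)
  then show "u \<in> vertices \<Gamma>" "v \<in> vertices \<Gamma>" "u \<noteq> v" by auto
qed

lemma group_aut_group: "group (aut_group \<Gamma>)"
proof -
  interpret B: group "BijGroup (vertices \<Gamma>)" by (rule group_BijGroup)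
  have mult: "f \<otimes>\<^bsub>BijGroup (vertices \<Gamma>)\<^esub> g = compose (vertices \<Gamma>) f g"
    if "f \<in> Bij (vertices \<Gamma>)" "g \<in> Bij (vertices \<Gamma>)" for f g
    using that by (simp add: BijGroup_def)
  have Bij: "f x \<in> vertices \<Gamma>" if "f \<in> Bij (vertices \<Gamma>)" "x \<in> vertices \<Gamma>" for f x
    using that Bij_imp_funcset by fastforce
  have "subgroup (automorphisms \<Gamma>) (BijGroup (vertices \<Gamma>))"
  proof (rule B.subgroupI)
    show "automorphisms \<Gamma> \<subseteq> carrier (BijGroup (vertices \<Gamma>))"
      by (auto simp: automorphisms_def BijGroup_def)
    show "automorphisms \<Gamma> \<noteq> {}"
      using id_Bij [of "vertices \<Gamma>"] by (auto simp: automorphisms_def intro!: exI [of _ "\<lambda>x\<in>vertices \<Gamma>. x"])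
  next
    fix f assume f: "f \<in> automorphisms \<Gamma>"
    then have fB: "f \<in> Bij (vertices \<Gamma>)" by (simp add: automorphisms_def)
    have inv: "inv\<^bsub>BijGroup (vertices \<Gamma>)\<^esub> f = (\<lambda>x\<in>vertices \<Gamma>. inv_into (vertices \<Gamma>) f x)"
      using fB by (rule inv_BijGroup)
    have r: "f (inv_into (vertices \<Gamma>) f x) = x" if "x \<in> vertices \<Gamma>" for x
      using fB that by (auto simp: Bij_def bij_betw_def intro: f_inv_into_f)
    have m: "inv_into (vertices \<Gamma>) f x \<in> vertices \<Gamma>" if "x \<in> vertices \<Gamma>" for x
      using fB that by (rule Bij_inv_into_mem)
    have "(u, v) \<in> adj \<Gamma> \<longleftrightarrow> (inv_into (vertices \<Gamma>) f u, inv_into (vertices \<Gamma>) f v) \<in> adj \<Gamma>"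
      if "u \<in> vertices \<Gamma>" "v \<in> vertices \<Gamma>" for u v
      using f m [OF that(1)] m [OF that(2)] r [OF that(1)] r [OF that(2)]
      by (auto simp: automorphisms_def)
    then show "inv\<^bsub>BijGroup (vertices \<Gamma>)\<^esub> f \<in> automorphisms \<Gamma>"
      using restrict_inv_into_Bij [OF fB] by (simp add: inv automorphisms_def)
  next
    fix f g assume fg: "f \<in> automorphisms \<Gamma>" "g \<in> automorphisms \<Gamma>"
    then have "f \<in> Bij (vertices \<Gamma>)" "g \<in> Bij (vertices \<Gamma>)" by (simp_all add: automorphisms_def)
    then show "f \<otimes>\<^bsub>BijGroup (vertices \<Gamma>)\<^esub> g \<in> automorphisms \<Gamma>"
      using fg Bij by (simp add: mult automorphisms_def compose_Bij compose_eq)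
  qed
  then show ?thesis
    unfolding aut_group_def by (rule B.subgroup_imp_group)
qed

lemma perm_orbits_eq: "perm_orbits V M = (\<lambda>x. (\<lambda>g. g x) ` M) ` V"
  by (auto simp: perm_orbits_def orbits_def orbit_def perm_group_def image_iff)

text \<open>The isomorphism numbers the parts by \<open>i\<close> and the vertices inside part
  \<open>p\<close> by \<open>j p\<close>; the latter is possible with the same range for every part
  because all parts have \<open>f\<close> elements.\<close>

lemma complete_multipartite_iso:
  assumes fin: "finite (vertices \<Gamma>)"
    and adj: "\<And>x y. x \<in> vertices \<Gamma> \<Longrightarrow> y \<in> vertices \<Gamma> \<Longrightarrow> (x, y) \<in> adj \<Gamma> \<longleftrightarrow> part x \<noteq> part y"
    and size: "\<And>x. x \<in> vertices \<Gamma> \<Longrightarrow> card {y \<in> vertices \<Gamma>. part y = part x} = f"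
  shows "graph_isomorphic \<Gamma> (complete_multipartite (card (part ` vertices \<Gamma>)) f)"
proof -
  let ?V = "vertices \<Gamma>" and ?m = "card (part ` vertices \<Gamma>)"
  define cls where "cls p = {y \<in> ?V. part y = p}" for p
  obtain i where i: "bij_betw i (part ` ?V) {..<?m}"
    using fin by (metis finite_imageI ex_bij_betw_finite_nat atLeast0LessThan)
  have "\<exists>j. bij_betw j (cls p) {..<f}" if "p \<in> part ` ?V" for p
  proof -
    have "finite (cls p)" "card (cls p) = f" using that fin size by (auto simp: cls_def)
    then show ?thesis by (metis ex_bij_betw_finite_nat atLeast0LessThan)
  qed
  then obtain j where j: "\<And>p. p \<in> part ` ?V \<Longrightarrow> bij_betw (j p) (cls p) {..<f}"
    by metis
  define h where "h x = (i (part x), j (part x) x)" for x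
  have i_inj: "i (part x) = i (part y) \<longleftrightarrow> part x = part y" if "x \<in> ?V" "y \<in> ?V" for x y
    using i that by (auto simp: bij_betw_def inj_on_eq_iff)
  have range: "i (part x) < ?m" "j (part x) x < f" if "x \<in> ?V" for x
    using bij_betwE [OF i] bij_betwE [OF j [of "part x"]] that by (auto simp: cls_def)
  have "inj_on h ?V"
  proof (rule inj_onI)
    fix x y assume xy: "x \<in> ?V" "y \<in> ?V" and "h x = h y"
    then have "part x = part y" "j (part x) x = j (part x) y"
      using i_inj by (auto simp: h_def)
    moreover have "inj_on (j (part x)) (cls (part x))"
      using j xy(1) by (auto simp: bij_betw_def)
    ultimately show "x = y" using xy by (auto simp: cls_def dest: inj_onD)
  qed
  moreover have "h ` ?V = {..<?m} \<times> {..<f}"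
  proof (intro equalityI subsetI)
    fix q assume "q \<in> {..<?m} \<times> {..<f}"
    then obtain k l where q: "q = (k, l)" "k < ?m" "l < f" by auto
    then obtain p where p: "p \<in> part ` ?V" "i p = k"
      using bij_betw_imp_surj_on [OF i] by (metis imageE lessThan_iff)
    then obtain x where "x \<in> cls p" "j p x = l"
      using bij_betw_imp_surj_on [OF j] q(3) by (metis imageE lessThan_iff)
    then show "q \<in> h ` ?V" using p q by (auto simp: h_def cls_def intro!: image_eqI [of _ _ x])
  qed (use range in \<open>auto simp: h_def\<close>)
  ultimately have "bij_betw h ?V (vertices (complete_multipartite ?m f))"
    by (simp add: bij_betw_def complete_multipartite_def)
  moreover have "(x, y) \<in> adj \<Gamma> \<longleftrightarrow> (h x, h y) \<in> adj (complete_multipartite ?m f)"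
    if "x \<in> ?V" "y \<in> ?V" for x y
  proof -
    have "(h x, h y) \<in> adj (complete_multipartite ?m f) \<longleftrightarrow> i (part x) \<noteq> i (part y)"
      using range that by (auto simp: adj_def complete_multipartite_def h_def doubleton_eq_iff) metis
    then show ?thesis using adj i_inj that by simp
  qed
  ultimately show ?thesis unfolding graph_isomorphic_def by blast
qed

section \<open>Orbits of a normal subgroup\<close>

locale normal_quotient =
  fixes \<Gamma> :: "'v graph" and G N :: "('v \<Rightarrow> 'v) set"
  assumes simple: "finite_simple_graph \<Gamma>"
    and connected: "connected_graph \<Gamma>"
    and subgroup_G: "subgroup G (aut_group \<Gamma>)"
    and transitive: "distance_transitive (perm_group (vertices \<Gamma>) G) (\<lambda>g. g) 2 \<Gamma>"
    and not_multipartite: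
      "\<And>m f. m \<ge> 3 \<Longrightarrow> f \<ge> 2 \<Longrightarrow> \<not> graph_isomorphic \<Gamma> (complete_multipartite m f)"
    and normal_N: "N \<lhd> perm_group (vertices \<Gamma>) G"
    and three_orbits: "card (perm_orbits (vertices \<Gamma>) N) \<ge> 3"
begin

abbreviation V where "V \<equiv> vertices \<Gamma>"
abbreviation E (infix "\<sim>" 50) where "u \<sim> v \<equiv> (u, v) \<in> adj \<Gamma>"
abbreviation PG where "PG \<equiv> perm_group V G"

definition orb :: "'v \<Rightarrow> 'v set" where "orb x = (\<lambda>g. g x) ` N"

lemma carrier_PG [simp]: "carrier PG = G"
  by (simp add: perm_group_def)

lemma G_automorphisms: "G \<subseteq> automorphisms \<Gamma>"
  using subgroup.subset [OF subgroup_G] by (simp add: aut_group_def)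

lemma G_Bij: "g \<in> G \<Longrightarrow> g \<in> Bij V"
  using G_automorphisms by (auto simp: automorphisms_def)

lemma G_closed [simp]: "g \<in> G \<Longrightarrow> x \<in> V \<Longrightarrow> g x \<in> V"
  using G_Bij Bij_imp_funcset by fastforce

lemma G_inj: "g \<in> G \<Longrightarrow> inj_on g V"
  using G_Bij by (auto simp: Bij_def bij_betw_def)

lemma G_surj: "g \<in> G \<Longrightarrow> g ` V = V"
  using G_Bij by (auto simp: Bij_def bij_betw_def)

lemma E_in_V: "u \<sim> v \<Longrightarrow> u \<in> V" "u \<sim> v \<Longrightarrow> v \<in> V"
  using finite_simple_graph_adjD [OF simple] by blast+

lemma G_adj: "g \<in> G \<Longrightarrow> u \<sim> v \<Longrightarrow> g u \<sim> g v"
  using G_automorphisms E_in_V [of u v] unfolding automorphisms_def by blast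

lemma PG_mult [simp]: "g \<in> G \<Longrightarrow> h \<in> G \<Longrightarrow> g \<otimes>\<^bsub>PG\<^esub> h = compose V g h"
  using G_Bij by (simp add: perm_group_def BijGroup_def)

lemma PG_one: "\<one>\<^bsub>PG\<^esub> = (\<lambda>x\<in>V. x)"
  by (simp add: perm_group_def BijGroup_def)

lemma G_eqI: "g \<in> G \<Longrightarrow> h \<in> G \<Longrightarrow> (\<And>x. x \<in> V \<Longrightarrow> g x = h x) \<Longrightarrow> g = h"
  using G_Bij by (meson Bij_imp_extensional extensionalityI)

sublocale PG: group PG
proof -
  have "aut_group \<Gamma>\<lparr>carrier := G\<rparr> = PG"
    by (simp add: aut_group_def perm_group_def)
  then show "group PG"
    using group.subgroup_imp_group [OF group_aut_group subgroup_G] by simp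
qed

sublocale N: normal N PG
  by (rule normal_N)

lemma N_subset_G: "g \<in> N \<Longrightarrow> g \<in> G"
  using N.subset by auto

lemma PG_inv: "g \<in> G \<Longrightarrow> inv\<^bsub>PG\<^esub> g \<in> G"
  using PG.inv_closed by simp

lemma PG_inv_apply: "g \<in> G \<Longrightarrow> x \<in> V \<Longrightarrow> (inv\<^bsub>PG\<^esub> g) (g x) = x"
  and PG_inv_apply2: "g \<in> G \<Longrightarrow> x \<in> V \<Longrightarrow> g ((inv\<^bsub>PG\<^esub> g) x) = x"
proof -
  assume g: "g \<in> G" "x \<in> V"
  have "(inv\<^bsub>PG\<^esub> g) (g x) = (inv\<^bsub>PG\<^esub> g \<otimes>\<^bsub>PG\<^esub> g) x"
    using g PG_inv by (simp add: compose_eq)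
  then show "(inv\<^bsub>PG\<^esub> g) (g x) = x"
    using g by (simp del: PG_mult add: PG_one)
  have "g ((inv\<^bsub>PG\<^esub> g) x) = (g \<otimes>\<^bsub>PG\<^esub> inv\<^bsub>PG\<^esub> g) x"
    using g PG_inv by (simp add: compose_eq)
  then show "g ((inv\<^bsub>PG\<^esub> g) x) = x"
    using g by (simp del: PG_mult add: PG_one)
qed

lemma finite_V: "finite V"
  using simple by (simp add: finite_simple_graph_def)

lemma perm_orbits_N: "perm_orbits V N = orb ` V"
  by (simp add: perm_orbits_eq orb_def)

lemma orb_subset: "x \<in> V \<Longrightarrow> orb x \<subseteq> V"
  using N_subset_G by (auto simp: orb_def)

lemma orb_memI: "g \<in> N \<Longrightarrow> g x \<in> orb x"
  by (simp add: orb_def)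

lemma orb_refl: "x \<in> V \<Longrightarrow> x \<in> orb x"
  using orb_memI [OF N.one_closed, of x] by (simp add: PG_one)

lemma orb_eqI: "x \<in> V \<Longrightarrow> y \<in> orb x \<Longrightarrow> orb y = orb x"
proof -
  assume x: "x \<in> V" and "y \<in> orb x"
  then obtain g where g: "g \<in> N" "y = g x" by (auto simp: orb_def)
  have "h y \<in> orb x" if "h \<in> N" for h
  proof -
    have "(h \<otimes>\<^bsub>PG\<^esub> g) x = h y" using that g x N_subset_G by (simp add: compose_eq)
    moreover have "h \<otimes>\<^bsub>PG\<^esub> g \<in> N" using that g by simp
    ultimately show ?thesis by (metis orb_memI)
  qed
  moreover have "h x \<in> orb y" if "h \<in> N" for h
  proof -
    have "(h \<otimes>\<^bsub>PG\<^esub> inv\<^bsub>PG\<^esub> g) y = h x"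
      using that g x N_subset_G PG_inv PG_inv_apply by (simp add: compose_eq)
    moreover have "h \<otimes>\<^bsub>PG\<^esub> inv\<^bsub>PG\<^esub> g \<in> N" using that g by simp
    ultimately show ?thesis by (metis orb_memI)
  qed
  ultimately show "orb y = orb x" by (auto simp: orb_def)
qed

lemma mem_orb_iff: "x \<in> V \<Longrightarrow> y \<in> V \<Longrightarrow> y \<in> orb x \<longleftrightarrow> orb y = orb x"
  using orb_eqI orb_refl by blast

text \<open>By normality a conjugate of \<open>h\<close> moves \<open>g x\<close> to
  \<open>g (h x)\<close>, which gives one inclusion. The other is the same inclusion for the inverse
  of \<open>g\<close>.\<close>

lemma image_orb:
  assumes "g \<in> G" and "x \<in> V"
  shows "g ` orb x = orb (g x)"
proof -
  have sub: "g ` orb x \<subseteq> orb (g x)" if "g \<in> G" "x \<in> V" for g x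
  proof
    fix y assume "y \<in> g ` orb x"
    then obtain h where h: "h \<in> N" "y = g (h x)" by (auto simp: orb_def)
    have "g \<otimes>\<^bsub>PG\<^esub> h \<otimes>\<^bsub>PG\<^esub> inv\<^bsub>PG\<^esub> g \<in> N"
      using N.inv_op_closed2 [of g h] that h by simp
    moreover have "(g \<otimes>\<^bsub>PG\<^esub> h \<otimes>\<^bsub>PG\<^esub> inv\<^bsub>PG\<^esub> g) (g x) = y"
      using that h N_subset_G [OF h(1)] PG_inv PG_inv_apply PG.m_closed [of g h] by (simp add: compose_eq)
    ultimately show "y \<in> orb (g x)" by (metis orb_memI)
  qed
  have "orb (g x) = g ` (inv\<^bsub>PG\<^esub> g) ` orb (g x)"
    using orb_subset [of "g x"] assms PG_inv_apply2 by (force simp: image_image)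
  also have "\<dots> \<subseteq> g ` orb x"
    using sub [of "inv\<^bsub>PG\<^esub> g" "g x"] assms PG_inv PG_inv_apply by (intro image_mono) simp
  finally show ?thesis using sub [OF assms] by blast
qed

lemma orb_cong: "g \<in> G \<Longrightarrow> x \<in> V \<Longrightarrow> y \<in> V \<Longrightarrow> orb x = orb y \<Longrightarrow> orb (g x) = orb (g y)"
  using image_orb by metis

section \<open>Transitivity of \<open>G\<close> and the covering property\<close>

lemma vertex_transitive: "u \<in> V \<Longrightarrow> v \<in> V \<Longrightarrow> \<exists>g\<in>G. g u = v"
  using transitive transitive_action.unique_orbit by (fastforce simp: distance_transitive_def)

lemma arc_transitive:
  assumes "u \<sim> v" and "u' \<sim> v'"
  shows "\<exists>g\<in>G. g u = u' \<and> g v = v'"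
proof -
  have "at_distance \<Gamma> 1 u v" if "u \<sim> v" for u v
    using that finite_simple_graph_adjD [OF simple that] by (auto simp: at_distance_def)
  then show ?thesis
    using assms transitive unfolding distance_transitive_def carrier_PG
    by (metis atLeastAtMost_iff le_numeral_extra(4) one_le_numeral)
qed

text \<open>Distance 2 is unfolded into having a common neighbour while being distinct and
  nonadjacent, the form in which such pairs arise below.\<close>

lemma distance2_transitive:
  assumes "u \<sim> w" "w \<sim> v" "u \<noteq> v" "\<not> u \<sim> v"
    and "u' \<sim> w'" "w' \<sim> v'" "u' \<noteq> v'" "\<not> u' \<sim> v'"
  shows "\<exists>g\<in>G. g u = u' \<and> g v = v'"
proof -
  have "at_distance \<Gamma> 2 u v" if "u \<sim> w" "w \<sim> v" "u \<noteq> v" "\<not> u \<sim> v" for u v w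
    using that E_in_V by (auto simp: at_distance_def numeral_2_eq_2 less_Suc_eq)
  then have "at_distance \<Gamma> 2 u v" "at_distance \<Gamma> 2 u' v'"
    using assms by blast+
  then show ?thesis
    using transitive unfolding distance_transitive_def carrier_PG
    by (metis atLeastAtMost_iff le_refl one_le_numeral)
qed

lemma E_path: "u \<in> V \<Longrightarrow> v \<in> V \<Longrightarrow> (u, v) \<in> (adj \<Gamma>)\<^sup>*"
  using connected by (auto simp: connected_graph_def)

text \<open>The sets \<open>B\<close> and \<open>C\<close> are arbitrary; with both empty the lemma
  merely provides a vertex.\<close>

lemma third_orbit: "\<exists>w\<in>V. orb w \<noteq> B \<and> orb w \<noteq> C"
proof (rule ccontr)
  assume "\<not> ?thesis"
  then have "perm_orbits V N \<subseteq> {B, C}" by (auto simp: perm_orbits_N)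
  then have "card (perm_orbits V N) \<le> card {B, C}" by (intro card_mono) auto
  also have "\<dots> \<le> 2" by (simp add: card_insert_if)
  finally show False using three_orbits by simp
qed

text \<open>One edge inside an orbit would, by arc-transitivity, put every edge inside an orbit, and
  connectedness would leave a single orbit.\<close>

lemma E_orb_neq:
  assumes "u \<sim> v"
  shows "orb u \<noteq> orb v"
proof
  assume eq: "orb u = orb v"
  have *: "orb x = orb y" if "x \<sim> y" for x y
    using arc_transitive [OF assms that] orb_cong eq E_in_V assms by blast
  have "orb u = orb x" if "x \<in> V" for x
    using E_path [OF E_in_V(1) [OF assms] that]
    by (induction rule: rtrancl_induct) (auto simp: *)
  then show False using third_orbit [of "orb u" "orb u"] by metis
qed

lemma E_lift:
  assumes "u \<sim> v" and "u' \<in> orb u"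
  shows "\<exists>v'\<in>orb v. u' \<sim> v'"
  using assms N_subset_G G_adj unfolding orb_def by blast

text \<open>The neighbours \<open>v\<close> and \<open>w\<close> of \<open>u\<close> are at distance 2 and in the same orbit, hence so is every
  pair of vertices at distance 2.\<close>

lemma multipartite_if_two_neighbours:
  assumes "u \<sim> v" "u \<sim> w" "orb v = orb w" "v \<noteq> w"
    and "x \<in> V" "y \<in> V"
  shows "x \<sim> y \<longleftrightarrow> orb x \<noteq> orb y"
proof -
  have "\<not> v \<sim> w" using assms(3) E_orb_neq by blast
  then have same: "orb x = orb y" if "x \<sim> z" "z \<sim> y" "x \<noteq> y" "\<not> x \<sim> y" for x y z
    using distance2_transitive [OF adj_sym [OF assms(1)] assms(2,4) _ that] orb_cong assms(1-3) E_in_V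
    by metis
  have step: "x \<sim> y" if "x \<sim> z" "z \<sim> y" "orb x \<noteq> orb y" for x y z
    using same that by metis
  \<comment> \<open>Every vertex has neighbours in all other orbits: along a path from
    \<open>x\<close>, a neighbour in the current orbit is continued by a lifted edge, and
    \<open>step\<close> shortens the resulting walk of length 2.\<close>
  have complete: "\<exists>y'\<in>orb y. x \<sim> y'" if "x \<in> V" "y \<in> V" "orb x \<noteq> orb y" for x y
  proof -
    from E_path [OF that(1,2)] have "orb x = orb y \<or> (\<exists>y'\<in>orb y. x \<sim> y')"
    proof (induction rule: rtrancl_induct)
      case (step y z)
      note yz = E_in_V [OF step(2)]
      show ?case
      proof (cases "orb x = orb y")
        case True
        then have "x \<in> orb y" using orb_refl [OF that(1)] by simp
        then show ?thesis using E_lift [OF step(2)] by blast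
      next
        case False
        with step obtain y' where y': "y' \<in> orb y" "x \<sim> y'" by blast
        obtain z' where z': "z' \<in> orb z" "y' \<sim> z'" using E_lift [OF step(2) y'(1)] by blast
        then have "orb z' = orb z" using orb_eqI yz by blast
        then show ?thesis using \<open>\<And>x y z. x \<sim> z \<Longrightarrow> z \<sim> y \<Longrightarrow> orb x \<noteq> orb y \<Longrightarrow> x \<sim> y\<close> y' z' by metis
      qed
    qed simp
    then show ?thesis using that by blast
  qed
  \<comment> \<open>The invariant along a path from \<open>x\<close> bounds the distance by 2 and
    records that nonadjacent vertices share an orbit.\<close>
  from E_path [OF assms(5,6)]
  have "(orb x = orb y \<and> (x = y \<or> (\<exists>p. x \<sim> p \<and> p \<sim> y))) \<or> x \<sim> y"
  proof (induction rule: rtrancl_induct)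
    case base
    then show ?case by simp
  next
    case (step y z)
    note yz = E_in_V [OF step(2)]
    have st: "\<And>x y z. x \<sim> z \<Longrightarrow> z \<sim> y \<Longrightarrow> orb x \<noteq> orb y \<Longrightarrow> x \<sim> y" by fact
    consider "x \<sim> y" | "x = y" | p where "orb x = orb y" "x \<sim> p" "p \<sim> y"
      using step by blast
    then show ?case
    proof cases
      case 1
      then show ?thesis using st step(2) by blast
    next
      case 2
      then show ?thesis using step(2) by simp
    next
      case 3
      have xz: "orb x \<noteq> orb z" using E_orb_neq [OF step(2)] 3 by simp
      show ?thesis
      proof (cases "orb p = orb z")
        case False
        then show ?thesis using st [of p y z] st [of x p z] 3 step(2) xz by blast
      next
        case True
        \<comment> \<open>Here \<open>p\<close> and \<open>z\<close> share an orbit, so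
          \<open>p\<close> cannot be joined to \<open>z\<close>. A neighbour \<open>r\<close> of
          \<open>p\<close> in a third orbit replaces it: \<open>r\<close> is adjacent to
          \<open>x\<close> and \<open>y\<close>, hence to \<open>z\<close>.\<close>
        obtain r0 where r0: "r0 \<in> V" "orb r0 \<noteq> orb x" "orb r0 \<noteq> orb p"
          using third_orbit [of "orb x" "orb p"] by metis
        then obtain r where r: "r \<in> orb r0" "p \<sim> r"
          using complete [of p r0] E_in_V 3 by metis
        then have "orb r = orb r0" using orb_eqI r0 by blast
        then have "x \<sim> r" "y \<sim> r"
          using st [of x p r] st [of y p r] 3 r r0 adj_sym by metis+
        then have "r \<sim> z"
          using st [of r y z] adj_sym step(2) True r0 \<open>orb r = orb r0\<close> by metis
        then show ?thesis using st [of x r z] \<open>x \<sim> r\<close> xz by blast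
      qed
    qed
  qed
  then show ?thesis using E_orb_neq by blast
qed

text \<open>Otherwise the orbits would be the parts of a complete multipartite graph. They have
  equal size since \<open>G\<close> permutes them transitively, there are at least three, and the
  one containing \<open>v\<close> and \<open>w\<close> has at least two elements.\<close>

lemma neighbour_unique:
  assumes "u \<sim> v" "u \<sim> w" "orb v = orb w"
  shows "v = w"
proof (rule ccontr)
  assume "v \<noteq> w"
  have v: "v \<in> V" "w \<in> V" using E_in_V assms by auto
  have cls: "{y \<in> V. orb y = orb x} = orb x" if "x \<in> V" for x
    using mem_orb_iff [OF that] orb_subset [OF that] by blast
  have "card (orb x) = card (orb v)" if "x \<in> V" for x
  proof -
    obtain g where g: "g \<in> G" "g v = x" using vertex_transitive [of v x] v(1) \<open>x \<in> V\<close> by auto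
    then have "orb x = g ` orb v" using image_orb v by simp
    moreover have "inj_on g (orb v)" using G_inj [OF g(1)] orb_subset [OF v(1)] by (rule inj_on_subset)
    ultimately show ?thesis by (simp add: card_image)
  qed
  then have "graph_isomorphic \<Gamma> (complete_multipartite (card (orb ` V)) (card (orb v)))"
    using multipartite_if_two_neighbours [OF assms \<open>v \<noteq> w\<close>] finite_V cls
    by (intro complete_multipartite_iso) auto
  moreover have "card (orb ` V) \<ge> 3" using three_orbits by (simp add: perm_orbits_N)
  moreover have "card (orb v) \<ge> 2"
  proof -
    have "{v, w} \<subseteq> orb v" using orb_refl [OF v(1)] orb_refl [OF v(2)] assms(3) by simp
    moreover have "finite (orb v)" using finite_V orb_subset v finite_subset by blast
    ultimately have "card {v, w} \<le> card (orb v)" by (rule card_mono [rotated])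
    then show ?thesis using \<open>v \<noteq> w\<close> by simp
  qed
  ultimately show False using not_multipartite by blast
qed

text \<open>Fixed points spread along edges: if \<open>y\<close> is fixed and \<open>z\<close> is a
  neighbour, then \<open>k z\<close> is a neighbour of \<open>y\<close> in the orbit of
  \<open>z\<close>, so it is \<open>z\<close>.\<close>

lemma kernel_semiregular:
  assumes k: "k \<in> G" "\<And>x. x \<in> V \<Longrightarrow> orb (k x) = orb x" and "x \<in> V" "k x = x" and "y \<in> V"
  shows "k y = y"
  using E_path [OF \<open>x \<in> V\<close> \<open>y \<in> V\<close>]
proof (induction rule: rtrancl_induct)
  case (step y z)
  then have "y \<sim> k z" using G_adj [OF k(1) step(2)] by simp
  moreover have "orb (k z) = orb z" using k(2) E_in_V [OF step(2)] by blast
  ultimately show ?case using neighbour_unique step(2) by blast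
qed (rule assms(4))

text \<open>The product of the inverse of \<open>g\<close> with \<open>k\<close> preserves all
  orbits and fixes \<open>x\<close>, so semiregularity makes it trivial.\<close>

lemma kernel_subset_N:
  assumes k: "k \<in> G" "\<And>x. x \<in> V \<Longrightarrow> orb (k x) = orb x" and "x \<in> V" and g: "g \<in> N" "g x = k x"
  shows "k = g"
proof -
  have gG: "g \<in> G" using g N_subset_G by blast
  define l where "l = inv\<^bsub>PG\<^esub> g \<otimes>\<^bsub>PG\<^esub> k"
  have "l \<in> G" using PG.m_closed [of "inv\<^bsub>PG\<^esub> g" k] PG_inv gG k unfolding l_def by simp
  have l: "l y = (inv\<^bsub>PG\<^esub> g) (k y)" if "y \<in> V" for y
    using that PG_inv gG k by (simp add: l_def compose_eq)
  have orb_N: "orb (h y) = orb y" if "h \<in> N" "y \<in> V" for h y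
    using that orb_eqI by (auto simp: orb_def)
  have "orb (l y) = orb y" if "y \<in> V" for y
    using orb_N [of "inv\<^bsub>PG\<^esub> g" "k y"] that k g l by simp
  moreover have "l x = x" using l [OF assms(3)] g(2) PG_inv_apply [OF gG assms(3)] by simp
  ultimately have "l y = y" if "y \<in> V" for y
    using kernel_semiregular [of l x y] \<open>l \<in> G\<close> assms(3) that by blast
  then have "k y = g y" if "y \<in> V" for y
    using PG_inv_apply2 [OF gG, of "k y"] l that k by simp
  then show ?thesis using G_eqI k gG by blast
qed

text \<open>As \<open>k x\<close> lies in the orbit of \<open>x\<close>, some element of
  \<open>N\<close> agrees with \<open>k\<close> at \<open>x\<close>, hence everywhere. So
  \<open>N\<close> is the whole kernel of \<open>G\<close> on the orbits.\<close>

lemma kernel_in_N: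
  assumes k: "k \<in> G" "\<And>x. x \<in> V \<Longrightarrow> orb (k x) = orb x"
  shows "k \<in> N"
proof -
  obtain x where x: "x \<in> V" using third_orbit [of "{}" "{}"] by blast
  then have "k x \<in> orb x" using k mem_orb_iff [OF x, of "k x"] by simp
  then obtain g where "g \<in> N" "g x = k x" by (auto simp: orb_def)
  then show ?thesis using kernel_subset_N k x by metis
qed

section \<open>The quotient graph and the action of the factor group\<close>

abbreviation \<Gamma>N where "\<Gamma>N \<equiv> quotient_graph \<Gamma> N"
abbreviation GN where "GN \<equiv> PG Mod N"
abbreviation \<phi> where "\<phi> \<equiv> quotient_action V N"

lemma vertices_quotient: "vertices \<Gamma>N = orb ` V"
  by (simp add: quotient_graph_def perm_orbits_N)

lemma adj_quotientI:
  assumes "u \<sim> v"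
  shows "(orb u, orb v) \<in> adj \<Gamma>N"
proof -
  note uv = E_in_V [OF assms]
  have "orb u \<in> orb ` V" "orb v \<in> orb ` V" "u \<in> orb u" "v \<in> orb v" "orb u \<noteq> orb v"
    using uv orb_refl E_orb_neq [OF assms] by simp_all
  with assms have "{orb u, orb v} \<in> edges \<Gamma>N"
    unfolding quotient_graph_def perm_orbits_N graph.simps by blast
  then show ?thesis by (simp add: adj_def)
qed

lemma adj_quotientD:
  assumes "(B, C) \<in> adj \<Gamma>N"
  obtains u v where "u \<sim> v" "B = orb u" "C = orb v"
proof -
  obtain B' C' u v where *: "{B, C} = {B', C'}" "B' \<in> orb ` V" "C' \<in> orb ` V" "u \<in> B'" "v \<in> C'" "u \<sim> v"
  proof -
    have "{B, C} \<in> edges \<Gamma>N" using assms by (simp add: adj_def)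
    then show thesis
      unfolding quotient_graph_def perm_orbits_N graph.simps mem_Collect_eq
      by (elim exE conjE bexE) (rule that; assumption)
  qed
  then have "B' = orb u" "C' = orb v" using orb_eqI by auto
  then show thesis using * that [of u v] that [OF adj_sym [of u v \<Gamma>]] by (auto simp: doubleton_eq_iff)
qed

text \<open>An edge of the quotient lifts to one that starts at a prescribed vertex, which allows
  paths to be lifted.\<close>

lemma adj_quotientD':
  assumes "(orb u, C) \<in> adj \<Gamma>N" and "u \<in> V"
  obtains v where "u \<sim> v" "C = orb v"
proof -
  obtain u' v' where *: "u' \<sim> v'" "orb u = orb u'" "C = orb v'" using assms(1) by (rule adj_quotientD)
  then obtain v where "v \<in> orb v'" "u \<sim> v"
    using E_lift [OF *(1), of u] orb_refl assms(2) by auto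
  then show thesis using that * orb_eqI E_in_V by metis
qed

lemma cover: "cover_of_quotient \<Gamma> N"
  unfolding cover_of_quotient_def
proof (intro allI impI ballI)
  fix B C u assume BC: "(B, C) \<in> adj \<Gamma>N" and u: "u \<in> B"
  obtain u' v' where *: "u' \<sim> v'" "B = orb u'" "C = orb v'" using BC by (rule adj_quotientD)
  then obtain v where v: "v \<in> C" "u \<sim> v" using E_lift u by blast
  have orb_C: "orb w = C" if "w \<in> C" for w using that * orb_eqI E_in_V by blast
  show "\<exists>!v. v \<in> C \<and> u \<sim> v"
  proof (rule ex1I)
    show "v \<in> C \<and> u \<sim> v" using v by simp
    fix w assume "w \<in> C \<and> u \<sim> w"
    then show "w = v" using neighbour_unique [of u w v] v orb_C by auto
  qed
qed

lemma action_orb: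
  assumes "g \<in> G" and "x \<in> V"
  shows "\<phi> (N #>\<^bsub>PG\<^esub> g) (orb x) = orb (g x)"
proof -
  have "h ` orb x = orb (g x)" if h: "h \<in> N #>\<^bsub>PG\<^esub> g" for h
  proof -
    obtain k where "k \<in> N" "h = k \<otimes>\<^bsub>PG\<^esub> g"
      using h unfolding r_coset_def by blast
    then have k: "k \<in> N" "h = compose V k g" using assms N_subset_G by simp_all
    have "h \<in> G" using k assms N_subset_G PG.m_closed [of k g] by simp
    have "k (g x) \<in> orb (g x)" using k by (auto simp: orb_def)
    then have "orb (h x) = orb (g x)" using orb_eqI assms k by (simp add: compose_eq)
    then show ?thesis using image_orb \<open>h \<in> G\<close> assms by simp
  qed
  moreover have "g \<in> N #>\<^bsub>PG\<^esub> g" using PG.rcos_self [OF _ N.subgroup_axioms] assms by simp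
  ultimately have "(\<Union>h\<in>N #>\<^bsub>PG\<^esub> g. h ` orb x) = orb (g x)" by blast
  then show ?thesis using assms by (simp add: quotient_action_def perm_orbits_N)
qed

lemma carrier_GN: "carrier GN = (\<lambda>g. N #>\<^bsub>PG\<^esub> g) ` G"
  by (simp add: carrier_FactGroup)

lemma action_extensional: "\<phi> c \<in> extensional (orb ` V)"
  by (simp add: quotient_action_def perm_orbits_N)

lemma orb_eq_iff:
  assumes "g \<in> G" "x \<in> V" "y \<in> V"
  shows "orb (g x) = orb (g y) \<longleftrightarrow> orb x = orb y"
  using orb_cong [of g x y] orb_cong [of "inv\<^bsub>PG\<^esub> g" "g x" "g y"] assms PG_inv PG_inv_apply by auto

lemma action_Bij:
  assumes "c \<in> carrier GN"
  shows "\<phi> c \<in> Bij (orb ` V)"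
proof -
  obtain g where g: "g \<in> G" "c = N #>\<^bsub>PG\<^esub> g" using assms by (auto simp: carrier_GN)
  have "inj_on (\<phi> c) (orb ` V)"
    using g by (auto simp: inj_on_def action_orb orb_eq_iff)
  moreover have "\<phi> c ` orb ` V = orb ` g ` V"
    using g by (auto simp: image_image action_orb)
  ultimately show ?thesis
    using action_extensional by (simp add: Bij_def bij_betw_def G_surj g)
qed

lemma action_hom: "group_action GN (orb ` V) \<phi>"
proof -
  interpret Q: group GN by (rule N.factorgroup_is_group)
  interpret B: group "BijGroup (orb ` V)" by (rule group_BijGroup)
  have "\<phi> (c \<otimes>\<^bsub>GN\<^esub> d) = \<phi> c \<otimes>\<^bsub>BijGroup (orb ` V)\<^esub> \<phi> d" if cd: "c \<in> carrier GN" "d \<in> carrier GN" for c d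
  proof -
    obtain g h where g: "g \<in> G" "c = N #>\<^bsub>PG\<^esub> g" and h: "h \<in> G" "d = N #>\<^bsub>PG\<^esub> h"
      using cd by (auto simp: carrier_GN)
    have "c \<otimes>\<^bsub>GN\<^esub> d = N #>\<^bsub>PG\<^esub> (compose V g h)"
      using g h N.rcos_sum [of g h] by simp
    moreover have "compose V g h \<in> G"
      using g h PG.m_closed [of g h] by simp
    ultimately have "\<phi> (c \<otimes>\<^bsub>GN\<^esub> d) (orb x) = compose (orb ` V) (\<phi> c) (\<phi> d) (orb x)" if "x \<in> V" for x
      using that g h by (simp add: action_orb compose_eq)
    then have "\<phi> (c \<otimes>\<^bsub>GN\<^esub> d) = compose (orb ` V) (\<phi> c) (\<phi> d)"
      using action_extensional by (intro extensionalityI [of _ "orb ` V"]) auto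
    then show ?thesis
      using action_Bij cd by (simp add: BijGroup_def)
  qed
  then have "\<phi> \<in> hom GN (BijGroup (orb ` V))"
    using action_Bij by (intro homI) (auto simp: BijGroup_def)
  then show ?thesis
    by unfold_locales
qed

text \<open>If the cosets of \<open>g\<close> and \<open>h\<close> act alike, then \<open>g\<close>
  times the inverse of \<open>h\<close> preserves every orbit and thus lies in
  \<open>N\<close>.\<close>

lemma action_faithful: "faithful_action GN (orb ` V) \<phi>"
proof -
  interpret group_action GN "orb ` V" \<phi> by (rule action_hom)
  have "inj_on \<phi> (carrier GN)"
  proof (rule inj_onI)
    fix c d assume cd: "c \<in> carrier GN" "d \<in> carrier GN" and eq: "\<phi> c = \<phi> d"
    obtain g h where g: "g \<in> G" "c = N #>\<^bsub>PG\<^esub> g" and h: "h \<in> G" "d = N #>\<^bsub>PG\<^esub> h"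
      using cd by (auto simp: carrier_GN)
    have orb_gh: "orb (g x) = orb (h x)" if "x \<in> V" for x
      using eq action_orb that g h by metis
    define k where "k = g \<otimes>\<^bsub>PG\<^esub> inv\<^bsub>PG\<^esub> h"
    have "k \<in> G" using g h PG.m_closed [of g "inv\<^bsub>PG\<^esub> h"] PG_inv by (simp add: k_def)
    moreover have "orb (k x) = orb x" if "x \<in> V" for x
      using that g h PG_inv [OF h(1)] orb_gh [of "(inv\<^bsub>PG\<^esub> h) x"] PG_inv_apply2 [OF h(1) that]
      by (simp add: k_def compose_eq)
    ultimately have "k \<in> N" by (rule kernel_in_N)
    moreover have "g = k \<otimes>\<^bsub>PG\<^esub> h"
      using g h PG_inv by (simp add: k_def PG.m_assoc del: PG_mult)
    ultimately have "g \<in> N #>\<^bsub>PG\<^esub> h" by (auto simp: r_coset_def)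
    then show "c = d"
      using PG.repr_independence [OF _ _ N.subgroup_axioms] g h by simp
  qed
  then show ?thesis by unfold_locales
qed

lemma action_transitive: "transitive_action GN (orb ` V) \<phi>"
proof -
  interpret group_action GN "orb ` V" \<phi> by (rule action_hom)
  show ?thesis
  proof
    fix B C assume "B \<in> orb ` V" "C \<in> orb ` V"
    then obtain x y where xy: "x \<in> V" "y \<in> V" "B = orb x" "C = orb y" by blast
    then obtain g where "g \<in> G" "g x = y" using vertex_transitive [of x y] by blast
    then show "\<exists>c\<in>carrier GN. \<phi> c B = C"
      using xy by (auto simp: carrier_GN action_orb)
  qed
qed

lemma action_automorphism:
  assumes "c \<in> carrier GN"
  shows "\<phi> c \<in> automorphisms \<Gamma>N"
proof -
  obtain g where g: "g \<in> G" "c = N #>\<^bsub>PG\<^esub> g" using assms by (auto simp: carrier_GN)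
  have fwd: "(orb (g x), orb (g y)) \<in> adj \<Gamma>N" if xy: "(orb x, orb y) \<in> adj \<Gamma>N" "g \<in> G" "x \<in> V" "y \<in> V" for g x y
  proof -
    obtain u v where uv: "u \<sim> v" "orb x = orb u" "orb y = orb v" using xy(1) by (rule adj_quotientD)
    then have "(orb (g u), orb (g v)) \<in> adj \<Gamma>N" using G_adj xy(2) adj_quotientI by blast
    moreover have "orb (g x) = orb (g u)" "orb (g y) = orb (g v)"
      using xy uv E_in_V [OF uv(1)] by (simp_all add: orb_eq_iff)
    ultimately show ?thesis by simp
  qed
  have "(orb x, orb y) \<in> adj \<Gamma>N \<longleftrightarrow> (orb (g x), orb (g y)) \<in> adj \<Gamma>N" if "x \<in> V" "y \<in> V" for x y
    using fwd [of x y g] fwd [of "g x" "g y" "inv\<^bsub>PG\<^esub> g"] that g PG_inv PG_inv_apply by auto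
  then show ?thesis
    using g action_Bij [OF assms] by (simp add: automorphisms_def vertices_quotient action_orb)
qed

text \<open>Pairs of orbits at distance 1 or 2 lift to pairs of vertices at the same distance, where
  transitivity of \<open>G\<close> applies.\<close>

lemma quotient_distance_transitive: "distance_transitive GN \<phi> (min 2 (diam \<Gamma>N)) \<Gamma>N"
proof -
  have "\<exists>c\<in>carrier GN. \<phi> c B = B' \<and> \<phi> c C = C'"
    if i: "i \<in> {1..min 2 (diam \<Gamma>N)}" and BC: "at_distance \<Gamma>N i B C" "at_distance \<Gamma>N i B' C'" for i B C B' C'
  proof -
    have lift: "\<exists>g\<in>G. g u = u' \<and> g v = v' \<Longrightarrow> B = orb u \<Longrightarrow> B' = orb u' \<Longrightarrow> C = orb v \<Longrightarrow> C' = orb v' \<Longrightarrow> u \<in> V \<Longrightarrow> v \<in> V \<Longrightarrow> ?thesis"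
      for u v u' v'
      by (auto simp: carrier_GN action_orb)
    consider "i = 1" | "i = 2" using i by force
    then show ?thesis
    proof cases
      case 1
      then have "(B, C) \<in> adj \<Gamma>N" "(B', C') \<in> adj \<Gamma>N" using BC by (auto simp: at_distance_def)
      then obtain u v u' v' where "u \<sim> v" "B = orb u" "C = orb v" "u' \<sim> v'" "B' = orb u'" "C' = orb v'"
        using adj_quotientD by metis
      then show ?thesis using lift [of u u' v v'] arc_transitive [of u v u' v'] E_in_V [of u v] by blast
    next
      case 2
      have path: "\<exists>u w v. u \<sim> w \<and> w \<sim> v \<and> u \<noteq> v \<and> \<not> u \<sim> v \<and> B = orb u \<and> C = orb v"
        if d: "at_distance \<Gamma>N 2 B C" for B C
      proof -
        obtain D where BD: "(B, D) \<in> adj \<Gamma>N" and DC: "(D, C) \<in> adj \<Gamma>N"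
          using d by (auto simp: at_distance_def numeral_2_eq_2)
        have neq: "B \<noteq> C" "(B, C) \<notin> adj \<Gamma>N"
          using d by (auto simp: at_distance_def numeral_2_eq_2 less_Suc_eq all_conj_distrib)
        obtain u w where uw: "u \<sim> w" "B = orb u" "D = orb w" using BD by (rule adj_quotientD)
        \<comment> \<open>The second edge is lifted from \<open>w\<close> itself so that the two
          edges join. The ends are distinct and nonadjacent because their orbits are.\<close>
        then obtain v where v: "w \<sim> v" "C = orb v" using DC adj_quotientD' E_in_V by metis
        then show ?thesis using uw neq adj_quotientI by blast
      qed
      obtain u w v where 1: "u \<sim> w" "w \<sim> v" "u \<noteq> v" "\<not> u \<sim> v" "B = orb u" "C = orb v"
        using path [of B C] BC(1) 2 by blast
      obtain u' w' v' where 2: "u' \<sim> w'" "w' \<sim> v'" "u' \<noteq> v'" "\<not> u' \<sim> v'" "B' = orb u'" "C' = orb v'"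
        using path [of B' C'] BC(2) 2 by blast
      show ?thesis
        using lift [OF distance2_transitive [OF 1(1-4) 2(1-4)]] 1 2 E_in_V by metis
    qed
  qed
  then show ?thesis
    using action_transitive action_automorphism
    by (auto simp: distance_transitive_def vertices_quotient)
qed

text \<open>\<open>\<Union>M\<close> is the preimage of \<open>M\<close> in \<open>G\<close>, and
  each of its elements acts on the \<open>N\<close>-orbits as its coset does. The equation bounds
  the number of orbits of \<open>M\<close> by that of its preimage.\<close>

lemma quotient_orbits:
  assumes M: "M \<lhd> GN"
  shows "orbits (GN\<lparr>carrier := M\<rparr>) (orb ` V) \<phi> = (\<lambda>X. orb ` X) ` perm_orbits V (\<Union>M)"
proof -
  have sub: "M \<subseteq> carrier GN" using normal_imp_subgroup [OF M] by (rule subgroup.subset)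
  have "orbit (GN\<lparr>carrier := M\<rparr>) \<phi> (orb x) = orb ` (\<lambda>g. g x) ` \<Union>M" if x: "x \<in> V" for x
  proof -
    have rep: "\<phi> c (orb x) = orb (g x)" if "c \<in> M" "g \<in> c" for c g
    proof -
      obtain h where h: "h \<in> G" "c = N #>\<^bsub>PG\<^esub> h" using \<open>c \<in> M\<close> sub by (auto simp: carrier_GN)
      then have "g \<in> G" using that(2) PG.r_coset_subset_G [OF N.subset] by auto
      moreover have "c = N #>\<^bsub>PG\<^esub> g"
        using PG.repr_independence [OF _ _ N.subgroup_axioms] that h by simp
      ultimately show ?thesis using action_orb x by simp
    qed
    have "c \<noteq> {}" if "c \<in> M" for c
      using that sub PG.rcos_self [OF _ N.subgroup_axioms] by (fastforce simp: carrier_GN)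
    then have "\<exists>g. g \<in> c" if "c \<in> M" for c using that by blast
    then show ?thesis
      unfolding orbit_def using rep by (auto simp: image_iff) metis+
  qed
  then have "orbit (GN\<lparr>carrier := M\<rparr>) \<phi> ` orb ` V = (\<lambda>X. orb ` X) ` perm_orbits V (\<Union>M)"
    unfolding perm_orbits_eq image_image by (intro image_cong refl) (simp add: image_image)
  moreover have "orbits (GN\<lparr>carrier := M\<rparr>) (orb ` V) \<phi> = orbit (GN\<lparr>carrier := M\<rparr>) \<phi> ` orb ` V"
    by (auto simp: orbits_def)
  ultimately show ?thesis by simp
qed

end

section \<open>Consequences of the maximality of \<open>N\<close>\<close>

context normal_quotient
begin

text \<open>The preimage of a nontrivial normal subgroup properly contains \<open>N\<close>, so by
  maximality it has at most two orbits. The two alternatives correspond to whether some normal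
  subgroup attains two.\<close>

lemma quotient_quasiprimitive:
  assumes maximal: "\<And>M. M \<lhd> PG \<Longrightarrow> card (perm_orbits V M) \<ge> 3 \<Longrightarrow> N \<subseteq> M \<Longrightarrow> M = N"
  shows "quasiprimitive GN (orb ` V) \<phi> \<or> biquasiprimitive GN (orb ` V) \<phi>"
proof -
  interpret Q: group GN by (rule N.factorgroup_is_group)
  interpret act: group_action GN "orb ` V" \<phi> by (rule action_hom)
  have le2: "card (orbits (GN\<lparr>carrier := M\<rparr>) (orb ` V) \<phi>) \<le> 2"
    if M: "M \<lhd> GN" "M \<noteq> {\<one>\<^bsub>GN\<^esub>}" for M
  proof -
    have sub: "subgroup M GN" using M(1) by (rule normal_imp_subgroup)
    have U: "\<Union>M \<lhd> PG" using M(1) by (rule N.factgroup_subgroup_union_normal)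
    have "N \<in> M" using subgroup.one_closed [OF sub] by simp
    then have NU: "N \<subseteq> \<Union>M" by blast
    \<comment> \<open>A coset contained in \<open>N\<close> is \<open>N\<close> itself, so equality
      would make \<open>M\<close> trivial.\<close>
    have "\<Union>M \<noteq> N"
    proof
      assume eq: "\<Union>M = N"
      have "c = N" if c: "c \<in> M" for c
      proof -
        obtain g where g: "g \<in> G" "c = N #>\<^bsub>PG\<^esub> g"
          using c subgroup.subset [OF sub] by (auto simp: carrier_GN)
        then have "g \<in> c" using PG.rcos_self [OF _ N.subgroup_axioms] by simp
        then have "g \<in> N" using eq c by blast
        then show "c = N" using g N.rcos_const [OF PG.is_group] by simp
      qed
      then have "M = {N}" using \<open>N \<in> M\<close> by blast
      then show False using M(2) by simp
    qed
    then have "card (perm_orbits V (\<Union>M)) \<le> 2" using maximal [OF U _ NU] by fastforce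
    moreover have "finite (perm_orbits V (\<Union>M))" using finite_V by (simp add: perm_orbits_eq)
    ultimately show ?thesis
      unfolding quotient_orbits [OF M(1)] using card_image_le le_trans by blast
  qed
  show ?thesis
  proof (cases "\<exists>M. M \<lhd> GN \<and> card (orbits (GN\<lparr>carrier := M\<rparr>) (orb ` V) \<phi>) = 2")
    case True
    then show ?thesis
      unfolding biquasiprimitive_def using le2 action_faithful action_transitive by blast
  next
    case False
    have "transitive_action (GN\<lparr>carrier := M\<rparr>) (orb ` V) \<phi>" if M: "M \<lhd> GN" "M \<noteq> {\<one>\<^bsub>GN\<^esub>}" for M
    proof -
      have sub: "subgroup M GN" using M(1) by (rule normal_imp_subgroup)
      interpret M: group "GN\<lparr>carrier := M\<rparr>" by (rule Q.subgroup_imp_group [OF sub])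
      interpret B: group "BijGroup (orb ` V)" by (rule group_BijGroup)
      have "\<phi> \<in> hom GN (BijGroup (orb ` V))"
        using act.group_hom by (simp add: group_hom.homh)
      then have "\<phi> \<in> hom (GN\<lparr>carrier := M\<rparr>) (BijGroup (orb ` V))"
        using subgroup.subset [OF sub] by (auto simp: hom_def Pi_def)
      then interpret A: group_action "GN\<lparr>carrier := M\<rparr>" "orb ` V" \<phi>
        by unfold_locales
      let ?O = "orbits (GN\<lparr>carrier := M\<rparr>) (orb ` V) \<phi>"
      have O: "?O = orbit (GN\<lparr>carrier := M\<rparr>) \<phi> ` orb ` V" by (auto simp: orbits_def)
      then have "finite ?O" using finite_V by simp
      moreover have "?O \<noteq> {}" using O third_orbit [of "{}" "{}"] by auto
      moreover have "card ?O \<noteq> 2" using False M(1) by blast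
      ultimately have "card ?O = 1" using le2 [OF M] by (cases "card ?O") auto
      then obtain X where X: "?O = {X}" by (auto simp: card_1_singleton_iff)
      show ?thesis
      proof
        fix x y assume "x \<in> orb ` V" "y \<in> orb ` V"
        then have "orbit (GN\<lparr>carrier := M\<rparr>) \<phi> x \<in> ?O" "orbit (GN\<lparr>carrier := M\<rparr>) \<phi> y \<in> ?O"
          unfolding O by blast+
        then have "y \<in> orbit (GN\<lparr>carrier := M\<rparr>) \<phi> x"
          using X A.orbit_refl [OF \<open>y \<in> orb ` V\<close>] by auto
        then show "\<exists>g\<in>carrier (GN\<lparr>carrier := M\<rparr>). \<phi> g x = y"
          by (auto simp: orbit_def)
      qed
    qed
    then show ?thesis
      unfolding quasiprimitive_def using action_faithful action_transitive by blast
  qed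
qed

end

section \<open>Quotients of Cayley graphs over generalized quaternion groups\<close>

locale quaternion_normal_quotient =
  quaternion_presentation T a b n + normal_quotient \<Gamma> G N
  for T :: "'t monoid" (structure) and a b n and \<Gamma> :: "'t graph" and G N +
  fixes S :: "'t set"
  assumes n_pos: "n \<ge> 1"
    and S_subset: "S \<subseteq> carrier T"
    and S_inv: "(\<lambda>s. inv s) ` S = S"
    and cayley: "\<Gamma> = cayley_graph T S"
    and right_mult_G: "right_mult T ` carrier T \<subseteq> G"
begin

section \<open>Orbits as cosets of a subgroup of \<open>T\<close>\<close>

lemma V_eq: "V = carrier T"
  by (simp add: cayley cayley_graph_def)

lemma inv_S: "s \<in> S \<Longrightarrow> inv s \<in> S"
  using S_inv by blast

lemma adj_iff: "u \<sim> v \<longleftrightarrow> u \<in> carrier T \<and> (\<exists>s\<in>S. v = s \<otimes> u)"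
proof
  assume "u \<sim> v"
  then obtain g s where "{u, v} = {g, s \<otimes> g}" and gs: "g \<in> carrier T" "s \<in> S"
    unfolding adj_def cayley cayley_graph_def by auto
  then have "u = g \<and> v = s \<otimes> g \<or> u = s \<otimes> g \<and> v = g" by (auto simp: doubleton_eq_iff)
  moreover have "g = inv s \<otimes> (s \<otimes> g)" "s \<otimes> g \<in> carrier T"
    using gs S_subset by (auto simp: m_assoc [symmetric])
  ultimately show "u \<in> carrier T \<and> (\<exists>s\<in>S. v = s \<otimes> u)"
    using gs inv_S by metis
qed (auto simp: adj_def cayley cayley_graph_def)

lemma one_adj: "s \<in> S \<Longrightarrow> \<one> \<sim> s"
  using S_subset by (force simp: adj_iff)

lemma right_mult_in_G: "t \<in> carrier T \<Longrightarrow> right_mult T t \<in> G"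
  using right_mult_G by blast

definition H where "H = orb \<one>"

text \<open>Right multiplication by \<open>x\<close> belongs to \<open>G\<close>, hence carries the
  orbit of the identity onto the orbit of \<open>x\<close>.\<close>

lemma orb_eq_coset: "x \<in> carrier T \<Longrightarrow> orb x = H #> x"
proof -
  assume x: "x \<in> carrier T"
  have "orb x = right_mult T x ` H"
    using image_orb [OF right_mult_in_G [OF x], of \<one>] x by (simp add: H_def V_eq right_mult_def)
  also have "\<dots> = H #> x"
    using orb_subset [of \<one>] by (auto simp: right_mult_def r_coset_def H_def V_eq)
  finally show ?thesis .
qed

text \<open>For \<open>h\<close> in \<open>H\<close> the orbit of \<open>h\<close> is both
  \<open>H\<close> and \<open>H #> h\<close>. This equality gives products, and inverses because the
  identity lies in \<open>H #> h\<close>.\<close>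

lemma H_subgroup: "subgroup H T"
proof (rule subgroupI)
  show "H \<subseteq> carrier T" using orb_subset [of \<one>] by (simp add: H_def V_eq)
  show "H \<noteq> {}" using orb_refl [of \<one>] by (auto simp: H_def V_eq)
  have coset: "H #> h = H" if "h \<in> H" for h
    using that orb_eqI [of \<one> h] orb_eq_coset [of h] orb_subset [of \<one>] by (auto simp: H_def V_eq)
  show "x \<otimes> y \<in> H" if "x \<in> H" "y \<in> H" for x y
    using coset [OF that(2)] that(1) by (auto simp: r_coset_def)
  show "inv x \<in> H" if x: "x \<in> H" for x
  proof -
    have "\<one> \<in> H #> x" using coset [OF x] orb_refl [of \<one>] by (simp add: H_def V_eq)
    then obtain y where "y \<in> H" "y \<otimes> x = \<one>" by (auto simp: r_coset_def)
    then show ?thesis using inv_equality [of y x] x \<open>H \<subseteq> carrier T\<close> by auto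
  qed
qed

text \<open>Otherwise walks starting at the identity would stay among the powers of \<open>a\<close>
  and never reach \<open>b\<close>.\<close>

lemma exists_generator_outside_cyclic: "\<exists>k :: int. a [^] k \<otimes> b \<in> S"
proof (rule ccontr)
  assume contra: "\<not> ?thesis"
  have S: "\<exists>k :: int. s = a [^] k" if "s \<in> S" for s
  proof -
    have "s \<in> carrier T" using that S_subset by blast
    then show ?thesis by (cases rule: element_cases) (use that contra in blast)+
  qed
  have "(\<one>, b) \<in> (adj \<Gamma>)\<^sup>*" by (rule E_path) (simp_all add: V_eq)
  then have "\<exists>k :: int. b = a [^] k"
  proof (induction rule: rtrancl_induct)
    case base
    show ?case by (rule exI [of _ 0]) simp
  next
    case (step y z)
    then obtain k m :: int where "y = a [^] k" "z = a [^] m \<otimes> y" using S adj_iff by metis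
    then have "z = a [^] (m + k)" by (simp add: int_pow_mult)
    then show ?case by blast
  qed
  then show False using b_neq_a_pow by blast
qed

text \<open>If \<open>a\<^sup>n\<close> were in \<open>H\<close>, then a generator \<open>s = a\<^sup>k b\<close> and its inverse \<open>a\<^sup>-\<^sup>n s\<close>
  would be distinct neighbours of \<open>1\<close> in the same \<open>N\<close>-orbit.\<close>

lemma a_pow_n_notin_H: "a [^] n \<notin> H"
proof
  assume z: "a [^] n \<in> H"
  obtain k :: int where s: "a [^] k \<otimes> b \<in> S" using exists_generator_outside_cyclic by blast
  define s where "s = a [^] k \<otimes> b"
  have sT: "s \<in> carrier T" by (simp add: s_def)
  have ss: "s \<otimes> s = a [^] n" unfolding s_def by (rule square_a_pow_b)
  have "inv s = inv (a [^] n) \<otimes> s"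
    using sT by (simp add: ss [symmetric] inv_mult_group m_assoc)
  moreover have "inv (a [^] n) \<in> H" using z H_subgroup by (rule subgroup.m_inv_closed [rotated])
  ultimately have "inv s \<in> orb s"
    using orb_eq_coset [OF sT] by (auto simp: r_coset_def)
  then have "orb s = orb (inv s)" using orb_eqI [of s "inv s"] sT by (simp add: V_eq)
  moreover have "\<one> \<sim> s" "\<one> \<sim> inv s"
    using s inv_S one_adj by (auto simp: s_def)
  ultimately have "s = inv s" using neighbour_unique by blast
  then have "s \<otimes> s = \<one>" using sT by (metis r_inv)
  then show False using ss a_pow_n_neq_one n_pos by simp
qed

text \<open>Orbits are right cosets, so right multiplication by \<open>h\<close> preserves them once
  left and right cosets of \<open>H\<close> agree; it then lies in the kernel \<open>N\<close>.
  Conversely, \<open>g\<close> in \<open>N\<close> agrees at the identity with right multiplication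
  by \<open>g \<one>\<close>.\<close>

lemma N_eq_right_mult:
  assumes "H \<lhd> T"
  shows "N = right_mult T ` H"
proof -
  interpret H: normal H T by fact
  have orb_fix: "orb (right_mult T h x) = orb x" if "h \<in> H" "x \<in> V" for h x
  proof -
    have xT: "x \<in> carrier T" "h \<in> carrier T" using that H.subset by (auto simp: V_eq)
    have "x \<otimes> h \<in> x <# H" using that(1) by (auto simp: l_coset_def)
    then have "x \<otimes> h \<in> orb x" using H.coset_eq orb_eq_coset xT by simp
    then show ?thesis using orb_eqI that(2) xT by (simp add: right_mult_def)
  qed
  have sub: "right_mult T h \<in> N" if "h \<in> H" for h
    using kernel_in_N orb_fix right_mult_in_G that H.subset by blast
  have "g \<in> right_mult T ` H" if g: "g \<in> N" for g
  proof -
    have h: "g \<one> \<in> H" using orb_memI [OF g] by (simp add: H_def)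
    then have hT: "g \<one> \<in> carrier T" using H.subset by blast
    have "right_mult T (g \<one>) = g"
      using kernel_subset_N [of "right_mult T (g \<one>)" \<one> g] orb_fix h g hT right_mult_in_G
      by (simp add: V_eq right_mult_def)
    then show ?thesis using h by force
  qed
  then show ?thesis using sub by blast
qed

text \<open>The connection set \<open>S'\<close> is the image of \<open>S\<close> under the
  projection. It avoids the identity because adjacent vertices lie in different orbits.\<close>

lemma quotient_cayley:
  assumes "H \<lhd> T"
  shows "cayley_graph_over (T Mod H) \<Gamma>N"
proof -
  interpret H: normal H T by fact
  define S' where "S' = (\<lambda>s. H #> s) ` S"
  have mult: "(H #> s) <#> (H #> u) = orb (s \<otimes> u)" if "s \<in> carrier T" "u \<in> carrier T" for s u
    using that H.rcos_sum orb_eq_coset by simp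
  have "S' \<subseteq> carrier (T Mod H)" using S_subset by (auto simp: S'_def carrier_FactGroup)
  moreover have "\<one>\<^bsub>T Mod H\<^esub> \<notin> S'"
  proof
    assume "\<one>\<^bsub>T Mod H\<^esub> \<in> S'"
    then obtain s where s: "s \<in> S" "H #> s = H" by (auto simp: S'_def)
    then have "s \<in> carrier T" using S_subset by blast
    then have "orb s = orb \<one>" using orb_eq_coset [of s] s(2) H_def by simp
    moreover have "\<one> \<sim> s" using s one_adj by simp
    ultimately show False using E_orb_neq by metis
  qed
  moreover have "(\<lambda>c. inv\<^bsub>T Mod H\<^esub> c) ` S' = S'"
  proof -
    have "inv\<^bsub>T Mod H\<^esub> (H #> s) = H #> inv s" if "s \<in> S" for s
      using that S_subset H.inv_FactGroup [of "H #> s"] H.rcos_inv [of s] by (auto simp: carrier_FactGroup)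
    then have "(\<lambda>c. inv\<^bsub>T Mod H\<^esub> c) ` S' = (\<lambda>s. H #> s) ` (\<lambda>s. inv s) ` S"
      unfolding S'_def image_image by (intro image_cong) auto
    then show ?thesis by (simp add: S_inv S'_def)
  qed
  moreover have "\<Gamma>N = cayley_graph (T Mod H) S'"
  proof -
    have vert: "orb ` V = carrier (T Mod H)"
      using orb_eq_coset by (auto simp: V_eq carrier_FactGroup)
    have "edges \<Gamma>N = {{g, s \<otimes>\<^bsub>T Mod H\<^esub> g} |g s. g \<in> carrier (T Mod H) \<and> s \<in> S'}"
    proof (intro equalityI subsetI)
      fix e assume e: "e \<in> edges \<Gamma>N"
      then obtain B C where BC: "e = {B, C}" unfolding quotient_graph_def by auto
      \<comment> \<open>The edge is lifted to the original graph in order to read off an element of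
        \<open>S\<close>.\<close>
      then have "(B, C) \<in> adj \<Gamma>N" using e by (simp add: adj_def)
      then obtain u v where uv: "u \<sim> v" "B = orb u" "C = orb v" by (rule adj_quotientD)
      then obtain s where s: "s \<in> S" "v = s \<otimes> u" "u \<in> carrier T" by (auto simp: adj_iff)
      then have "C = (H #> s) \<otimes>\<^bsub>T Mod H\<^esub> B" "B \<in> carrier (T Mod H)" "H #> s \<in> S'"
        using uv mult [of s u] orb_eq_coset [of u] S_subset by (auto simp: carrier_FactGroup S'_def)
      then show "e \<in> {{g, s \<otimes>\<^bsub>T Mod H\<^esub> g} |g s. g \<in> carrier (T Mod H) \<and> s \<in> S'}"
        using BC by blast
    next
      fix e assume "e \<in> {{g, s \<otimes>\<^bsub>T Mod H\<^esub> g} |g s. g \<in> carrier (T Mod H) \<and> s \<in> S'}"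
      then obtain u s where us: "u \<in> carrier T" "s \<in> S" "e = {H #> u, (H #> s) <#> (H #> u)}"
        by (auto simp: S'_def carrier_FactGroup)
      then have "e = {orb u, orb (s \<otimes> u)}" using mult S_subset orb_eq_coset by auto
      moreover have "u \<sim> s \<otimes> u" using us by (auto simp: adj_iff)
      ultimately show "e \<in> edges \<Gamma>N" using adj_quotientI by (auto simp: adj_def)
    qed
    then show ?thesis
      using vert vertices_quotient by (simp add: cayley_graph_def)
  qed
  ultimately show ?thesis unfolding cayley_graph_over_def by blast
qed

text \<open>Applies the classification of subgroups avoiding \<open>a [^] n\<close> to
  \<open>H\<close>. The value \<open>i = 2\<close> forces \<open>n\<close> to be odd, since
  \<open>i\<close> does not divide \<open>n\<close>.\<close>

lemma quotient_cases:
  "\<exists>i A. i dvd 2 * n \<and> i \<noteq> 1 \<and> (N \<noteq> {\<one>\<^bsub>PG\<^esub>} \<longrightarrow> i \<noteq> 2 * n) \<and>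
     A = generate T {a [^] i} \<and> N = right_mult T ` A \<and> cayley_graph_over (T Mod A) \<Gamma>N \<and>
     ((T Mod A \<cong> integer_mod_group 4 \<and> i = 2 \<and> odd n) \<or>
      (T Mod A \<cong> generalized_quaternion_group (i div 2) \<and> i \<ge> 3 \<and> even i \<and> \<not> i dvd n))"
proof -
  obtain i :: nat where i: "i > 0" "i dvd 2 * n" "\<not> i dvd n" and H: "H = generate T {a [^] i}"
    using subgroup_a_powers [OF H_subgroup a_pow_n_notin_H] by metis
  have normal: "H \<lhd> T" unfolding H by (rule normal_a_powers)
  \<comment> \<open>An odd \<open>i\<close> would be coprime to 2, so dividing \<open>2 * n\<close>
    it would divide \<open>n\<close>.\<close>
  have "even i"
    using i coprime_dvd_mult_right_iff [of i 2 n] by (cases "even i") auto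
  then obtain m where m: "i = 2 * m" by blast
  have "N = {\<one>\<^bsub>PG\<^esub>}" if "i = 2 * n"
  proof -
    have "H = {\<one>}" unfolding H that a_pow_2n using generate_one by simp
    moreover have "right_mult T \<one> = \<one>\<^bsub>PG\<^esub>"
      unfolding PG_one unfolding V_eq right_mult_def by (rule restrict_ext) simp
    ultimately show ?thesis
      using N_eq_right_mult [OF normal] by (metis image_empty image_insert)
  qed
  moreover have "T Mod H \<cong> integer_mod_group 4 \<and> odd n" if "i = 2"
    using quotient_iso_cyclic4 i that unfolding H by auto
  moreover have "T Mod H \<cong> generalized_quaternion_group (i div 2)"
    using quotient_iso_quaternion [of m] i m unfolding H by simp
  moreover have "i = 2 \<or> i \<ge> 3" "i \<noteq> 1" using i m by auto
  ultimately show ?thesis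
    using i H \<open>even i\<close> N_eq_right_mult [OF normal] quotient_cayley [OF normal] by metis
qed

end

text \<open>A trivial \<open>N\<close> corresponds to trivial \<open>A\<close>, that is, to
  \<open>i = 2 * n\<close>; hence this value is excluded only for nontrivial
  \<open>N\<close>.\<close>

theorem theorem3p4:
  fixes n :: nat
    and T :: "'t monoid"
    and a b :: 't
    and \<Gamma> :: "'t graph"
    and G N :: "('t \<Rightarrow> 't) set"
  assumes "n \<ge> 2"
    and "group T"
    and "presented_by T a b (quaternion_relations n)"
    and "finite_simple_graph \<Gamma>"
    and "cayley_graph_over T \<Gamma>"
    and "connected_graph \<Gamma>"
    and "subgroup G (aut_group \<Gamma>)"
    and "right_mult T ` carrier T \<subseteq> G"
    and "distance_transitive (perm_group (vertices \<Gamma>) G) (\<lambda>g. g) 2 \<Gamma>"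
    and "\<forall>m f. m \<ge> 3 \<longrightarrow> f \<ge> 2 \<longrightarrow> \<not> graph_isomorphic \<Gamma> (complete_multipartite m f)"
    and "maximal_normal_ge3_orbits (vertices \<Gamma>) G N"
  shows
    "let V = vertices \<Gamma>;
         \<Gamma>N = quotient_graph \<Gamma> N;
         GN = perm_group V G Mod N;
         \<phi> = quotient_action V N
     in cover_of_quotient \<Gamma> N \<and>
        distance_transitive GN \<phi> (min 2 (diam \<Gamma>N)) \<Gamma>N \<and>
        faithful_action GN (vertices \<Gamma>N) \<phi> \<and>
        (quasiprimitive GN (vertices \<Gamma>N) \<phi> \<or> biquasiprimitive GN (vertices \<Gamma>N) \<phi>) \<and>
        (\<exists>i A. i dvd 2 * n \<and> i \<noteq> 1 \<and> (N \<noteq> {\<one>\<^bsub>perm_group V G\<^esub>} \<longrightarrow> i \<noteq> 2 * n) \<and>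
           A = generate T {a [^]\<^bsub>T\<^esub> i} \<and>
           N = right_mult T ` A \<and>
           cayley_graph_over (T Mod A) \<Gamma>N \<and>
           ((T Mod A \<cong> integer_mod_group 2 \<times>\<times> integer_mod_group 2 \<and> i = 2 \<and> even n) \<or>
            (T Mod A \<cong> integer_mod_group 4 \<and> i = 2 \<and> odd n) \<or>
            (T Mod A \<cong> generalized_quaternion_group (i div 2) \<and>
               i \<ge> 3 \<and> even i \<and> \<not> i dvd n) \<or>
            (T Mod A \<cong> dihedral_group i \<and> i \<ge> 3 \<and> i dvd n)))"
proof -
  obtain S where S: "S \<subseteq> carrier T" "(\<lambda>s. inv\<^bsub>T\<^esub> s) ` S = S" "\<Gamma> = cayley_graph T S"
    using assms(5) by (auto simp: cayley_graph_over_def)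
  have max: "N \<lhd> perm_group (vertices \<Gamma>) G" "card (perm_orbits (vertices \<Gamma>) N) \<ge> 3"
    "\<And>M. M \<lhd> perm_group (vertices \<Gamma>) G \<Longrightarrow> card (perm_orbits (vertices \<Gamma>) M) \<ge> 3 \<Longrightarrow> N \<subseteq> M \<Longrightarrow> M = N"
    using assms(11) unfolding maximal_normal_ge3_orbits_def by blast+
  interpret normal_quotient \<Gamma> G N
    by (intro normal_quotient.intro) (use assms max in blast)+
  interpret quaternion_presentation T a b n
    using assms by (simp add: quaternion_presentation_def quaternion_presentation_axioms_def)
  interpret quaternion_normal_quotient T a b n \<Gamma> G N S
    by unfold_locales (use assms(1,8) S in auto)
  show ?thesis
    unfolding Let_def vertices_quotient
    using cover quotient_distance_transitive action_faithful quotient_quasiprimitive [OF max(3)] quotient_cases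
    by blast
qed

end
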